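(* The elements $\mathbf P^{\pi}=\sum_{\mathbf a\sim\pi}\mathbf F_{\mathbf a}$, where $\pi$ runs over all non-decreasing signed parking functions, form the basis of a cocommutative Hopf subalgebra of $\mathbf{PQSym}^{(2)}$.
   Context: A parking function of length $n\ge0$ is a word $\mathbf a=a_1\cdots a_n$ on $\{1,\dots,n\}$ whose nondecreasing rearrangement $a'_1\cdots a'_n$ satisfies $a'_i\le i$ for all $i$. Parkization: for a word $w=w_1\cdots w_n$ over the positive integers, let $d(w)=\min\{i\ge1:|\{j:w_j\le i\}|<i\}$; if $d(w)=n+1$ then $\mathrm{Park}(w)=w$; otherwise decrease by $1$ all letters of $w$ greater than $d(w)$ to get $w'$ and set $\mathrm{Park}(w)=\mathrm{Park}(w')$. A level $2$ colored parking function of size $n$ is a pair $(\mathbf a,u)$ of a parking function $\mathbf a$ of length $n$ and a word $u\in\{0,1\}^n$, viewed as a word in the colored letters $(a_i,u_i)$. $\mathbf{PQSym}^{(2)}$ is the graded Hopf algebra over $\mathbb C$ whose basis $(\mathbf F_{(\mathbf a,u)})$, indexed by level $2$ colored parking functions (degree = size), has product the shifted shuffle $$\mathbf F_{(\mathbf a',u')}\mathbf F_{(\mathbf a'',u'')}=\sum\mathbf F_{(\mathbf a,u)},$$ where the sum is over all shuffles (with multiplicity) of the colored words $(\mathbf a',u')$ and $(\mathbf a''[k],u'')$, with $k=|\mathbf a'|$ and $\mathbf a''[k]$ the word obtained from $\mathbf a''$ by adding $k$ to all letters; and coproduct the parkized deconcatenation $$\Delta\mathbf F_{(\mathbf a,u)}=\sum_{(\mathbf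 a,u)=(v,s)\cdot(w,t)}\mathbf F_{(\mathrm{Park}(v),s)}\otimes\mathbf F_{(\mathrm{Park}(w),t)},$$ over all factorizations of the colored word by concatenation (including empty factors). This basis is dual to the basis $\mathbf G_{(\mathbf a,u)}$ with product $\mathbf G_{(\mathbf a',u')}\mathbf G_{(\mathbf a'',u'')}=\sum_{\mathbf a}\mathbf G_{(\mathbf a,u'\cdot u'')}$, where $\mathbf a$ runs over parking functions of length $|\mathbf a'|+|\mathbf a''|$ whose first $|\mathbf a'|$ letters parkize to $\mathbf a'$ and whose remaining letters parkize to $\mathbf a''$, and coproduct $\Delta\mathbf G_{(\mathbf a,u)}=\sum_{i}\mathbf G_{(\mathbf a,u)_{[1,i]}}\otimes\mathbf G_{(\mathbf a,u)_{[i+1,n]}}$ over $0\le i\le n$ with $|\{j:a_j\le i\}|=i$, where $(\mathbf a,u)_{[a,b]}$ is the parkization of the colored subword of letters with values in $[a,b]$. A parking function $\mathbf a$ of length $n\ge1$ is prime if the only $b\in\{1,\dots,n\}$ with $|\{i:a_i\le b\}|=b$ is $b=n$. Every non-decreasing parking function $\mathbf b$ factors uniquely as a maximal shifted concatenation $\mathbf b=\mathbf b_1\bullet\cdots\bullet\mathbf b_r$ of prime non-decreasing parking functions, where $w\bullet w'$ is $w$ followed by $w'$ with all letters of $w'$ increased by the length of $w$. A non-decreasing signed parking function $\pi$ is obtained from a non-decreasing parking function $\mathbf b$ by choosing a color in $\{0,1\}$ for each prime factor $\mathbf b_i$ and giving that color to all letters coming from this factor (the empty one is included). In the sum defining $\mathbf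 P^\pi$, $\mathbf a$ runs over the distinct level $2$ colored parking functions that are rearrangements of $\pi$ as words in colored letters; $\sim$ denotes equality up to rearrangement of the (colored) letters. *)

theory Defs
  imports Complex_Main "HOL-Library.Multiset" "HOL-Library.Poly_Mapping"
begin

section \<open>Parking functions and parkization\<close>

definition letters_le :: "nat \<Rightarrow> nat list \<Rightarrow> nat" where
  "letters_le b w = card {j. j < length w \<and> w ! j \<le> b}"

definition parking_function :: "nat list \<Rightarrow> bool" where
  "parking_function a \<longleftrightarrow>
     set a \<subseteq> {1..length a} \<and> (\<forall>i<length a. sort a ! i \<le> i + 1)"

definition prime_pf :: "nat list \<Rightarrow> bool" where
  "prime_pf a \<longleftrightarrow> parking_function a \<and> a \<noteq> [] \<and>
     {b \<in> {1..length a}. letters_le b a = b} = {length a}"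

definition park_d :: "nat list \<Rightarrow> nat" where
  "park_d w = (LEAST i. 1 \<le> i \<and> letters_le i w < i)"

lemma letters_le_bound: "letters_le b w \<le> length w"
proof -
  have "{j. j < length w \<and> w ! j \<le> b} \<subseteq> {..<length w}" by auto
  from card_mono[OF _ this] show ?thesis by (simp add: letters_le_def)
qed

lemma park_d_props:
  "1 \<le> park_d w" "letters_le (park_d w) w < park_d w" "park_d w \<le> length w + 1"
proof -
  let ?Q = "\<lambda>i. 1 \<le> i \<and> letters_le i w < i"
  have Q: "?Q (length w + 1)" using letters_le_bound[of "length w + 1" w] by simp
  have "?Q (park_d w)" unfolding park_d_def by (rule LeastI[of ?Q, OF Q])
  then show "1 \<le> park_d w" "letters_le (park_d w) w < park_d w" by auto
  show "park_d w \<le> length w + 1" unfolding park_d_def by (rule Least_le[of ?Q, OF Q])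
qed

function park :: "nat list \<Rightarrow> nat list" where
  "park w = (if park_d w = length w + 1 then w
             else park (map (\<lambda>x. if park_d w < x then x - 1 else x) w))"
  by pat_completeness auto
termination
proof (relation "measure sum_list")
  fix w :: "nat list"
  let ?d = "park_d w"
  let ?f = "\<lambda>x. if ?d < x then x - 1 else x"
  assume "?d \<noteq> length w + 1"
  then have d: "?d \<le> length w" using park_d_props(3)[of w] by simp
  have "\<exists>x\<in>set w. ?d < x"
  proof (rule ccontr)
    assume "\<not> ?thesis"
    then have "{j. j < length w \<and> w ! j \<le> ?d} = {..<length w}"
      by (auto simp: not_less)
    then have "letters_le ?d w = length w" by (simp add: letters_le_def)
    then show False using park_d_props(2)[of w] d by simp
  qed
  then obtain x where x: "x \<in> set w" "?d < x" by blast
  then obtain us vs where w: "w = us @ x # vs" by (meson split_list)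
  have le: "sum_list (map ?f zs) \<le> sum_list zs" for zs
    by (induction zs) auto
  have "sum_list (map ?f w) < sum_list w"
    using le[of us] le[of vs] x(2) by (subst (1 3) w) simp
  then show "(map ?f w, w) \<in> measure sum_list" by simp
qed simp

declare park.simps [simp del]


section \<open>Colored words\<close>

text \<open>A pair \<open>(a, u)\<close> of words of equal length is the list of its colored letters; the colors
  0 and 1 are \<open>False\<close> and \<open>True\<close>.\<close>

type_synonym cword = "(nat \<times> bool) list"

definition cpf :: "cword \<Rightarrow> bool" where
  "cpf w \<longleftrightarrow> parking_function (map fst w)"

definition cpark :: "cword \<Rightarrow> cword" where
  "cpark w = zip (park (map fst w)) (map snd w)"

definition cshift :: "nat \<Rightarrow> cword \<Rightarrow> cword" where
  "cshift k w = map (\<lambda>(x, c). (x + k, c)) w"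

definition cbullet :: "cword \<Rightarrow> cword \<Rightarrow> cword"  (infixr "\<bullet>\<^sub>c" 65) where
  "v \<bullet>\<^sub>c w = v @ cshift (length v) w"

fun mshuffles :: "'a list \<Rightarrow> 'a list \<Rightarrow> 'a list multiset" where
  "mshuffles [] ys = {#ys#}"
| "mshuffles xs [] = {#xs#}"
| "mshuffles (x # xs) (y # ys) =
     image_mset ((#) x) (mshuffles xs (y # ys)) + image_mset ((#) y) (mshuffles (x # xs) ys)"

lemma set_mset_mshuffles: "set_mset (mshuffles xs ys) = shuffles xs ys"
  by (induction xs ys rule: mshuffles.induct) auto

text \<open>A list of pairs (prime non-decreasing parking function, color) represents both a
  non-decreasing parking function, through its factorization into primes, and a choice of one
  color per prime factor. The empty list gives the empty word.\<close>

definition ndspf :: "cword set" where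
  "ndspf = {foldr (\<bullet>\<^sub>c) (map (\<lambda>(b, c). map (\<lambda>x. (x, c)) b) bs) [] | bs.
              \<forall>(b, c) \<in> set bs. prime_pf b \<and> sorted b}"


section \<open>Finitely supported functions as complex vector spaces\<close>

definition pscale :: "complex \<Rightarrow> ('a \<Rightarrow>\<^sub>0 complex) \<Rightarrow> ('a \<Rightarrow>\<^sub>0 complex)" where
  "pscale c f = Poly_Mapping.map ((*) c) f"

lemma lookup_pscale: "Poly_Mapping.lookup (pscale c f) a = c * Poly_Mapping.lookup f a"
  by (simp add: pscale_def Poly_Mapping.map.rep_eq when_def)

global_interpretation pvec: vector_space "pscale :: complex \<Rightarrow> ('a \<Rightarrow>\<^sub>0 complex) \<Rightarrow> _"
  by unfold_locales
    (auto intro!: poly_mapping_eqI simp: lookup_pscale lookup_add algebra_simps)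

definition lin_ext :: "('a \<Rightarrow> ('b \<Rightarrow>\<^sub>0 complex)) \<Rightarrow> ('a \<Rightarrow>\<^sub>0 complex) \<Rightarrow> ('b \<Rightarrow>\<^sub>0 complex)" where
  "lin_ext g f = (\<Sum>a\<in>Poly_Mapping.keys f. pscale (Poly_Mapping.lookup f a) (g a))"

definition basis_elt :: "'a \<Rightarrow> ('a \<Rightarrow>\<^sub>0 complex)" where
  "basis_elt a = Poly_Mapping.single a 1"

text \<open>The tensor product of the spaces with bases indexed by \<open>'a\<close> and \<open>'b\<close> is the space with
  basis indexed by \<open>'a \<times> 'b\<close>.\<close>

definition tensor :: "('a \<Rightarrow>\<^sub>0 complex) \<Rightarrow> ('b \<Rightarrow>\<^sub>0 complex) \<Rightarrow> ('a \<times> 'b \<Rightarrow>\<^sub>0 complex)" where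
  "tensor f g = lin_ext (\<lambda>a. lin_ext (\<lambda>b. basis_elt (a, b)) g) f"

definition tensor_space ::
    "('a \<Rightarrow>\<^sub>0 complex) set \<Rightarrow> ('b \<Rightarrow>\<^sub>0 complex) set \<Rightarrow> ('a \<times> 'b \<Rightarrow>\<^sub>0 complex) set" where
  "tensor_space U V = pvec.span {tensor f g | f g. f \<in> U \<and> g \<in> V}"

definition tensor_swap :: "('a \<times> 'b \<Rightarrow>\<^sub>0 complex) \<Rightarrow> ('b \<times> 'a \<Rightarrow>\<^sub>0 complex)" where
  "tensor_swap = lin_ext (\<lambda>(a, b). basis_elt (b, a))"


section \<open>The Hopf algebra of level 2 colored parking functions\<close>

text \<open>The operations are defined by linear extension on the span of all colored words; the Hopf
  algebra itself is the subspace \<open>PQSym2\<close> spanned by the colored parking functions, and only the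
  values of the operations there matter.\<close>

type_synonym pq = "cword \<Rightarrow>\<^sub>0 complex"

abbreviation \<F> :: "cword \<Rightarrow> pq" where
  "\<F> \<equiv> basis_elt"

definition PQSym2 :: "pq set" where
  "PQSym2 = pvec.span (\<F> ` Collect cpf)"

definition pq_mult :: "pq \<Rightarrow> pq \<Rightarrow> pq" where
  "pq_mult f g =
     lin_ext (\<lambda>a. lin_ext (\<lambda>b. \<Sum>w\<in>#mshuffles a (cshift (length a) b). \<F> w) g) f"

definition pq_one :: pq where
  "pq_one = \<F> []"

definition pq_comult :: "pq \<Rightarrow> (cword \<times> cword \<Rightarrow>\<^sub>0 complex)" where
  "pq_comult = lin_ext (\<lambda>a. \<Sum>i\<le>length a. basis_elt (cpark (take i a), cpark (drop i a)))"

definition pq_counit :: "pq \<Rightarrow> complex" where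
  "pq_counit f = Poly_Mapping.lookup f []"

definition pq_convolution :: "(pq \<Rightarrow> pq) \<Rightarrow> (pq \<Rightarrow> pq) \<Rightarrow> pq \<Rightarrow> pq" where
  "pq_convolution S T f = lin_ext (\<lambda>(a, b). pq_mult (S (\<F> a)) (T (\<F> b))) (pq_comult f)"

text \<open>The antipode of \<open>PQSym2\<close> is the two-sided convolution inverse of the identity, hence
  unique on \<open>PQSym2\<close>; the existential quantifier in \<open>hopf_subalgebra\<close> therefore refers to this one
  map. The Hopf algebra identities on a subspace are inherited from \<open>PQSym2\<close>.\<close>

definition pq_antipode :: "(pq \<Rightarrow> pq) \<Rightarrow> bool" where
  "pq_antipode S \<longleftrightarrow> Vector_Spaces.linear pscale pscale S \<and> S ` PQSym2 \<subseteq> PQSym2 \<and>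
     (\<forall>f\<in>PQSym2. pq_convolution S id f = pscale (pq_counit f) pq_one \<and>
                 pq_convolution id S f = pscale (pq_counit f) pq_one)"

definition hopf_subalgebra :: "pq set \<Rightarrow> bool" where
  "hopf_subalgebra H \<longleftrightarrow>
     H \<subseteq> PQSym2 \<and> pvec.subspace H \<and>
     pq_one \<in> H \<and> (\<forall>f\<in>H. \<forall>g\<in>H. pq_mult f g \<in> H) \<and>
     pq_comult ` H \<subseteq> tensor_space H H \<and>
     (\<exists>S. pq_antipode S \<and> S ` H \<subseteq> H)"

definition cocommutative_on :: "pq set \<Rightarrow> bool" where
  "cocommutative_on H \<longleftrightarrow> (\<forall>f\<in>H. tensor_swap (pq_comult f) = pq_comult f)"

definition \<P> :: "cword \<Rightarrow> pq" where
  "\<P> \<pi> = (\<Sum>a | cpf a \<and> mset a = mset \<pi>. \<F> a)"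

end

theory Submission
  imports Defs "HOL-Combinatorics.Multiset_Permutations"
begin

text \<open>On a rearrangement class, parkization acts through a single increasing relabelling of the
  letters, and this relabelling does not change the parkization of a subword. Summing over a whole
  class turns deconcatenation into splitting the multiset of letters in two,
  \<open>\<Delta> P(M) = \<Sum> P(Park A) \<otimes> P(Park B)\<close> over \<open>A + B = M\<close>, which is symmetric in \<open>A\<close> and \<open>B\<close>; and the
  shifted shuffle of two classes is the class of the shifted union. What remains is that
  parkization maps submultisets of signed parking functions to signed parking functions. The ends
  of the prime factors alone are not inherited by submultisets, but the bound
  \<open>#(letters in (c, b]) \<le> b - c\<close> for all \<open>c \<le> b\<close>, valid when a prime factor ends at \<open>b\<close>, is, and it
  survives parkization. The antipode is given by the usual recursion, which splits multisets in
  the same way and so preserves the subspace.\<close>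

section \<open>Parkization of subwords\<close>

lemma letters_le_filter: "letters_le b w = length (filter (\<lambda>x. x \<le> b) w)"
  by (simp add: letters_le_def length_filter_conv_card)

lemma letters_le_cong: "mset v = mset w \<Longrightarrow> letters_le b v = letters_le b w"
  by (metis letters_le_filter mset_filter size_mset)

text \<open>The \<open>i\<close>-th smallest letter is at most \<open>i\<close> exactly when at
  least \<open>i\<close> letters are at most \<open>i\<close>. The counts depend only on the
  multiset of letters and are the ones that \<open>park_d\<close> tests.\<close>

lemma parking_function_iff:
  "parking_function a \<longleftrightarrow> 0 \<notin> set a \<and> (\<forall>i\<le>length a. i \<le> letters_le i a)"
proof
  assume a: "parking_function a"
  have "i \<le> letters_le i a" if i: "i \<le> length a" for i
  proof (cases i)
    case (Suc j)
    have "{..<i} \<subseteq> {k. k < length (sort a) \<and> sort a ! k \<le> i}"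
    proof safe
      fix k assume k: "k < i"
      then show "k < length (sort a)" using i by simp
      have "sort a ! k \<le> k + 1" using a i k by (auto simp: parking_function_def)
      then show "sort a ! k \<le> i" using k by simp
    qed
    from card_mono[OF _ this] have "i \<le> letters_le i (sort a)"
      by (simp add: letters_le_def)
    then show ?thesis using letters_le_cong[of "sort a" a] by simp
  qed simp
  then show "0 \<notin> set a \<and> (\<forall>i\<le>length a. i \<le> letters_le i a)"
    using a by (auto simp: parking_function_def)
next
  assume a: "0 \<notin> set a \<and> (\<forall>i\<le>length a. i \<le> letters_le i a)"
  have "length (filter (\<lambda>x. x \<le> length a) a) = length a"
    using a letters_le_bound[of "length a" a] by (simp add: letters_le_filter dual_order.antisym)
  then have "\<forall>x\<in>set a. x \<le> length a"
    by (metis filter_id_conv length_filter_less linorder_not_less nless_le)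
  moreover have "x \<ge> 1" if "x \<in> set a" for x
    using that a by (metis One_nat_def not_less_eq_eq le_zero_eq)
  moreover have "sort a ! i \<le> i + 1" if i: "i < length a" for i
  proof (rule ccontr)
    assume n: "\<not> ?thesis"
    \<comment> \<open>If the letter at position \<open>i\<close> of the sorted word exceeds
      \<open>i + 1\<close>, sortedness confines the letters that are at most \<open>i + 1\<close> to
      the first \<open>i\<close> positions.\<close>
    have "{k. k < length (sort a) \<and> sort a ! k \<le> i + 1} \<subseteq> {..<i}"
    proof safe
      fix k assume k: "k < length (sort a)" "sort a ! k \<le> i + 1"
      show "k < i"
      proof (rule ccontr)
        assume "\<not> k < i"
        then have "sort a ! i \<le> sort a ! k" using k by (intro sorted_nth_mono) auto
        then show False using n k by simp
      qed
    qed
    from card_mono[OF _ this] have "letters_le (i + 1) (sort a) \<le> i"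
      by (simp add: letters_le_def)
    then have "letters_le (i + 1) a \<le> i" using letters_le_cong[of "sort a" a] by simp
    then show False using a i by (metis Suc_eq_plus1 Suc_leI not_less_eq_eq)
  qed
  ultimately show "parking_function a" by (auto simp: parking_function_def)
qed

lemma parking_function_cong: "mset v = mset w \<Longrightarrow> parking_function v \<longleftrightarrow> parking_function w"
  by (metis letters_le_cong mset_eq_length mset_eq_setD parking_function_iff)

definition cnt :: "nat \<Rightarrow> nat \<Rightarrow> nat list \<Rightarrow> nat" where
  "cnt c b w = length (filter (\<lambda>x. c < x \<and> x \<le> b) w)"

text \<open>In a parking function of length \<open>n \<ge> b\<close>, \<open>tight b\<close> says that exactly \<open>b\<close> letters are at most \<open>b\<close>,
  that is, that \<open>b\<close> ends a prime factor. Unlike the latter, it is inherited by subwords. Similarly,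
  \<open>gap d\<close> is an inherited form of \<open>d\<close> being the value removed by a parkization step.\<close>

definition tight :: "nat \<Rightarrow> nat list \<Rightarrow> bool" where
  "tight b w \<longleftrightarrow> (\<forall>c\<le>b. cnt c b w \<le> b - c)"

definition gap :: "nat \<Rightarrow> nat list \<Rightarrow> bool" where
  "gap d w \<longleftrightarrow> (\<forall>c<d. cnt c d w < d - c)"

text \<open>One relabelling step of \<open>park\<close>. It identifies \<open>d\<close> and
  \<open>d + 1\<close>, so it is injective only on words in which \<open>d\<close> does not
  occur.\<close>

definition skip :: "nat \<Rightarrow> nat \<Rightarrow> nat" where
  "skip d x = (if d < x then x - 1 else x)"

lemma cnt_split: "c \<le> b \<Longrightarrow> b \<le> d \<Longrightarrow> cnt c d w = cnt c b w + cnt b d w"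
  by (induction w) (auto simp: cnt_def)

lemma letters_le_cnt: "c \<le> d \<Longrightarrow> letters_le d w = letters_le c w + cnt c d w"
  by (induction w) (auto simp: cnt_def letters_le_filter)

lemma letters_le_0: "0 \<notin> set w \<Longrightarrow> letters_le 0 w = 0"
  by (auto simp: letters_le_filter filter_empty_conv intro: gr0I)

lemma cnt_0: "0 \<notin> set w \<Longrightarrow> cnt 0 d w = letters_le d w"
  using letters_le_cnt[of 0 d w] by (simp add: letters_le_0)

lemma cnt_mono: "mset v \<subseteq># mset w \<Longrightarrow> cnt c b v \<le> cnt c b w"
  unfolding cnt_def by (metis mset_filter multiset_filter_mono size_mset size_mset_mono)

lemma tight_mono: "mset v \<subseteq># mset w \<Longrightarrow> tight b w \<Longrightarrow> tight b v"
  unfolding tight_def using cnt_mono le_trans by blast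

lemma gap_mono: "mset v \<subseteq># mset w \<Longrightarrow> gap b w \<Longrightarrow> gap b v"
  unfolding gap_def using cnt_mono le_less_trans by blast

text \<open>The case \<open>c = d - 1\<close> of \<open>gap\<close> bounds the number of letters
  equal to \<open>d\<close> strictly by 1.\<close>

lemma gap_notin:
  assumes "gap d w" "1 \<le> d" shows "d \<notin> set w"
proof
  assume "d \<in> set w"
  then have "cnt (d - 1) d w \<noteq> 0" using assms(2) by (auto simp: cnt_def filter_empty_conv)
  moreover have "cnt (d - 1) d w < d - (d - 1)"
    using assms by (intro assms(1)[unfolded gap_def, rule_format]) simp
  ultimately show False using assms(2) by simp
qed

lemma cnt_skip:
  "cnt c b (map (skip d) w) = cnt (if c < d then c else c + 1) (if b < d then b else b + 1) w"
proof -
  have "c < skip d x \<longleftrightarrow> (if c < d then c else c + 1) < x"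
    "skip d x \<le> b \<longleftrightarrow> x \<le> (if b < d then b else b + 1)" for x
    by (auto simp: skip_def)
  then show ?thesis by (simp only: cnt_def filter_map length_map o_def)
qed

lemma letters_le_skip: "letters_le b (map (skip d) w) = letters_le (if b < d then b else b + 1) w"
proof -
  have "skip d x \<le> b \<longleftrightarrow> x \<le> (if b < d then b else b + 1)" for x
    by (auto simp: skip_def)
  then show ?thesis by (simp only: letters_le_filter filter_map length_map o_def)
qed

section \<open>The removed value and the recursion of \<open>park\<close>\<close>

lemma park_d_least: "1 \<le> i \<Longrightarrow> i < park_d w \<Longrightarrow> i \<le> letters_le i w"
  unfolding park_d_def using not_less_Least[of i "\<lambda>i. 1 \<le> i \<and> letters_le i w < i"] by simp

lemma park_d_eqI:
  assumes "1 \<le> e" "letters_le e u < e" "\<And>i. 1 \<le> i \<Longrightarrow> i < e \<Longrightarrow> i \<le> letters_le i u"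
  shows "park_d u = e"
  unfolding park_d_def
proof (rule Least_equality)
  fix i assume "1 \<le> i \<and> letters_le i u < i"
  then show "e \<le> i" using assms(3)[of i] by linarith
qed (use assms in simp)

lemma park_d_le: "1 \<le> i \<Longrightarrow> letters_le i w < i \<Longrightarrow> park_d w \<le> i"
  unfolding park_d_def by (rule Least_le, rule conjI)

lemma park_d_cong: "mset v = mset w \<Longrightarrow> park_d v = park_d w"
  by (simp add: park_d_def letters_le_cong[of v w])

lemma park_skip:
  "park w = (if park_d w = length w + 1 then w else park (map (skip (park_d w)) w))"
  by (subst park.simps) (simp add: skip_def[abs_def])

lemma park_induct:
  assumes "\<And>w. (park_d w \<noteq> length w + 1 \<Longrightarrow> Q (map (skip (park_d w)) w)) \<Longrightarrow> Q w"
  shows "Q w"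
proof (rule park.induct)
  fix w assume IH: "park_d w \<noteq> length w + 1 \<Longrightarrow>
    Q (map (\<lambda>x. if park_d w < x then x - 1 else x) w)"
  show "Q w"
    by (rule assms, unfold skip_def[abs_def]) (rule IH)
qed

text \<open>By minimality at least \<open>c\<close> letters are at most \<open>c\<close> for each
  \<open>c\<close> below the removed value \<open>d\<close>, while fewer than \<open>d\<close> are
  at most \<open>d\<close>; the difference is the strict bound.\<close>

lemma gap_park_d: "gap (park_d w) w"
  unfolding gap_def
proof safe
  fix c assume c: "c < park_d w"
  have "c \<le> letters_le c w" using park_d_least[of c w] c by (cases c) auto
  then show "cnt c (park_d w) w < park_d w - c"
    using letters_le_cnt[of c "park_d w" w] c park_d_props(2)[of w] by linarith
qed

lemma zero_notin_skip: "1 \<le> d \<Longrightarrow> 0 \<notin> set w \<Longrightarrow> 0 \<notin> set (map (skip d) w)"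
  by (auto simp: skip_def)

lemma skip_id: "\<forall>x\<in>set w. x \<le> d \<Longrightarrow> map (skip d) w = w"
  by (auto simp: skip_def intro!: map_idI)

lemma park_d_full_le:
  assumes "park_d w = length w + 1" shows "\<forall>x\<in>set w. x \<le> length w"
proof (cases "w = []")
  case False
  then have "length w \<le> length (filter (\<lambda>x. x \<le> length w) w)"
    using park_d_least[of "length w" w] assms by (simp add: letters_le_filter Suc_le_eq)
  then show ?thesis by (metis length_filter_less linorder_not_less)
qed simp

text \<open>For \<open>c\<close> below \<open>e\<close> the strict bounds on \<open>(c, e]\<close>
  and \<open>(e, d]\<close> add up with one unit to spare, which pays for the shorter interval; for
  other \<open>c\<close> both ends of the interval move together.\<close>

lemma gap_skip:
  assumes "gap e v" "gap d v" "e < d"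
  shows "gap (d - 1) (map (skip e) v)"
  unfolding gap_def
proof safe
  fix c assume c: "c < d - 1"
  show "cnt c (d - 1) (map (skip e) v) < d - 1 - c"
  proof (cases "c < e")
    case True
    then have "cnt c e v < e - c" "cnt e d v < d - e" using assms by (auto simp: gap_def)
    then have "cnt c d v < d - 1 - c" using True assms(3) cnt_split[of c e d v] by linarith
    then show ?thesis using True assms(3) by (auto simp: cnt_skip)
  next
    case False
    then have "cnt (c + 1) d v < d - (c + 1)" using assms(2) c by (auto simp: gap_def)
    then show ?thesis using False assms(3) c by (simp add: cnt_skip)
  qed
qed

text \<open>Every gap can be closed first; the recursion of \<open>park\<close> always closes the least one.\<close>

lemma park_close_gap:
  assumes "gap d v" "0 \<notin> set v" "1 \<le> d"
  shows "park (map (skip d) v) = park v"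
  using assms
proof (induction v arbitrary: d rule: park_induct)
  case (1 v)
  let ?e = "park_d v"
  note e = park_d_props[of v]
  \<comment> \<open>The case \<open>c = 0\<close> of \<open>gap d v\<close> says that fewer than
    \<open>d\<close> letters are at most \<open>d\<close>.\<close>
  have ed: "?e \<le> d"
    using 1(2-4) by (intro park_d_le) (metis Suc_le_lessD One_nat_def cnt_0 diff_zero gap_def)+
  consider "?e = length v + 1" | "?e \<noteq> length v + 1" "?e = d" | "?e \<noteq> length v + 1" "?e < d"
    using ed by linarith
  then show ?case
  proof cases
    case 1
    then have "map (skip d) v = v" using park_d_full_le[OF 1] ed by (intro skip_id) auto
    then show ?thesis by simp
  next
    case 2
    then show ?thesis by (subst (2) park_skip) simp
  next
    case 3
    \<comment> \<open>Closing \<open>d\<close> does not affect the counts up to values below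
      \<open>d\<close>, so the least deficient value is still \<open>?e\<close>.\<close>
    have pd: "park_d (map (skip d) v) = ?e"
      using 3 e park_d_least by (intro park_d_eqI) (auto simp: letters_le_skip)
    have "park (map (skip d) v) = park (map (skip ?e) (map (skip d) v))"
      using 3 by (subst park_skip) (simp add: pd)
    \<comment> \<open>The two closings commute once the larger gap is renumbered
      \<open>d - 1\<close>; the induction hypothesis then removes that gap from the word with
      \<open>?e\<close> closed.\<close>
    also have "map (skip ?e) (map (skip d) v) = map (skip (d - 1)) (map (skip ?e) v)"
      using 3 gap_notin[OF gap_park_d e(1)] gap_notin[OF 1(2,4)]
      by (auto simp: skip_def)
    also have "park \<dots> = park (map (skip ?e) v)"
      using 3 1(3) e(1) by (intro 1(1) gap_skip gap_park_d 1(2) zero_notin_skip) auto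
    also have "\<dots> = park v" using 3 by (subst (2) park_skip) simp
    finally show ?thesis .
  qed
qed

text \<open>If \<open>b\<close> moves down to \<open>b - 1\<close>, an interval starting below
  \<open>d\<close> must obey a bound smaller by one; the strict inequality of \<open>gap d\<close>
  on \<open>(c, d]\<close> supplies that unit.\<close>

lemma tight_skip:
  assumes "gap d w" "tight b w"
  shows "tight (if b < d then b else b - 1) (map (skip d) w)"
proof (cases "b < d")
  case True
  then show ?thesis using assms(2) by (auto simp: tight_def cnt_skip)
next
  case False
  have "cnt c (b - 1) (map (skip d) w) \<le> b - 1 - c" if c: "c \<le> b - 1" "1 \<le> b" for c
  proof (cases "c < d")
    case True
    then have "cnt c d w < d - c" "cnt d b w \<le> b - d"
      using assms False by (auto simp: gap_def tight_def)
    then have "cnt c b w \<le> b - 1 - c" using True False cnt_split[of c d b w] by linarith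
    moreover have "cnt c (b - 1) w \<le> cnt c b w" using cnt_split[of c "b - 1" b w] c by simp
    ultimately show ?thesis using True False c by (auto simp: cnt_skip)
  next
    case c': False
    then have "cnt (c + 1) b w \<le> b - (c + 1)" using assms(2) c by (auto simp: tight_def)
    then show ?thesis using False c' c by (auto simp: cnt_skip)
  qed
  \<comment> \<open>Here \<open>b = 0\<close> forces \<open>d = 0\<close>, and truncated subtraction
    leaves the bound at 0.\<close>
  moreover have "tight 0 u" for u by (auto simp: tight_def cnt_def filter_empty_conv)
  ultimately show ?thesis using False by (cases "b = 0") (simp_all add: tight_def)
qed

text \<open>The function \<open>f\<close> is the composite of all \<open>skip\<close> steps of the
  recursion. Each removed value depends only on the multiset and is not a letter, which gives the
  common relabelling and its monotonicity. Bounds travel by \<open>tight_skip\<close>, and on a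
  subword each step closes an inherited gap, which \<open>park_close_gap\<close> allows.\<close>

lemma park_letter_map:
  assumes "0 \<notin> set w"
  obtains f where "strict_mono_on (set w) f"
    and "\<And>w'. mset w' = mset w \<Longrightarrow> park w' = map f w'"
    and "\<And>b. tight b w \<Longrightarrow> \<exists>b'. tight b' (map f w) \<and> (\<forall>x\<in>set w. f x \<le> b' \<longleftrightarrow> x \<le> b)"
    and "\<And>v. mset v \<subseteq># mset w \<Longrightarrow> park (map f v) = park v"
    and "parking_function (map f w)"
proof -
  \<comment> \<open>The clauses are bundled so that the induction yields one \<open>f\<close>
    serving all of them.\<close>
  define P where "P w f \<longleftrightarrow> strict_mono_on (set w) f \<and>
    (\<forall>w'. mset w' = mset w \<longrightarrow> park w' = map f w') \<and>
    (\<forall>b. tight b w \<longrightarrow> (\<exists>b'. tight b' (map f w) \<and> (\<forall>x\<in>set w. f x \<le> b' \<longleftrightarrow> x \<le> b))) \<and>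
    (\<forall>v. mset v \<subseteq># mset w \<longrightarrow> park (map f v) = park v) \<and> parking_function (map f w)" for w f
  have "\<exists>f. P w f"
    using assms
  proof (induction w rule: park_induct)
    case (1 w)
    let ?d = "park_d w"
    note d = park_d_props(1)[of w]
    show ?case
    proof (cases "?d = length w + 1")
      case True
      have "park w' = w'" if "mset w' = mset w" for w'
        using True park_d_cong[OF that] mset_eq_length[OF that] by (subst park_skip) simp
      moreover have "i \<le> letters_le i w" if "i \<le> length w" for i
        using that True park_d_least[of i w] by (cases i) auto
      then have "parking_function w" using 1(2) by (simp add: parking_function_iff)
      ultimately have "P w id" by (auto simp: P_def strict_mono_on_def)
      then show ?thesis by blast
    next
      case False
      define s where "s = skip ?d"
      have "?d \<notin> set w" using gap_park_d d by (rule gap_notin)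
      then have nd: "x \<noteq> ?d" if "x \<in> set w" for x using that by blast
      have sm: "strict_mono_on (set w) s"
      proof (rule strict_mono_onI)
        fix x y assume "x \<in> set w" "y \<in> set w" "x < y"
        then show "s x < s y" using nd[of x] nd[of y] by (auto simp: s_def skip_def)
      qed
      obtain f where "P (map s w) f"
        using 1(1)[OF False zero_notin_skip[OF d 1(2)]] by (auto simp: s_def)
      then have f: "strict_mono_on (set (map s w)) f"
        "\<And>w'. mset w' = mset (map s w) \<Longrightarrow> park w' = map f w'"
        "\<And>b. tight b (map s w) \<Longrightarrow>
          \<exists>b'. tight b' (map f (map s w)) \<and> (\<forall>x\<in>set (map s w). f x \<le> b' \<longleftrightarrow> x \<le> b)"
        "\<And>v. mset v \<subseteq># mset (map s w) \<Longrightarrow> park (map f v) = park v"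
        "parking_function (map f (map s w))"
        unfolding P_def by blast+
      \<comment> \<open>The first step \<open>s\<close> is followed by the relabelling
        \<open>f\<close> of the word it produces.\<close>
      have "P w (f \<circ> s)"
        unfolding P_def
      proof (intro conjI allI impI)
        show "strict_mono_on (set w) (f \<circ> s)"
          using sm f(1) by (auto simp: strict_mono_on_def)
      next
        fix w' assume w': "mset w' = mset w"
        have "park w' = park (map s w')"
          using False mset_eq_length[OF w']
          by (subst park_skip) (simp add: park_d_cong[OF w'] s_def)
        also have "\<dots> = map f (map s w')" using w' by (intro f(2)) simp
        finally show "park w' = map (f \<circ> s) w'" by simp
      next
        fix b assume b: "tight b w"
        let ?b = "if b < ?d then b else b - 1"
        have "s x \<le> ?b \<longleftrightarrow> x \<le> b" if "x \<in> set w" for x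
          using nd[OF that] d by (auto simp: s_def skip_def)
        then show "\<exists>b'. tight b' (map (f \<circ> s) w) \<and> (\<forall>x\<in>set w. (f \<circ> s) x \<le> b' \<longleftrightarrow> x \<le> b)"
          using f(3)[of ?b] tight_skip[OF gap_park_d b] by (simp add: s_def)
      next
        fix v assume v: "mset v \<subseteq># mset w"
        have "park (map f (map s v)) = park (map s v)"
          using v by (intro f(4)) (simp add: image_mset_subseteq_mono)
        also have "\<dots> = park v"
          unfolding s_def using gap_mono[OF v gap_park_d] 1(2) d set_mset_mono[OF v]
          by (intro park_close_gap) auto
        finally show "park (map (f \<circ> s) v) = park v" by simp
      qed (use f(5) in simp)
      then show ?thesis by blast
    qed
  qed
  then show thesis using that unfolding P_def by blast
qed

section \<open>The shifted shuffle algebra and convolution\<close>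

lemma lin_ext_superset:
  assumes "finite A" "Poly_Mapping.keys f \<subseteq> A"
  shows "lin_ext g f = (\<Sum>a\<in>A. pscale (Poly_Mapping.lookup f a) (g a))"
  unfolding lin_ext_def by (rule sum.mono_neutral_left) (use assms in \<open>auto simp: in_keys_iff\<close>)

lemma lin_ext_add: "lin_ext g (f + h) = lin_ext g f + lin_ext g h"
proof -
  let ?A = "Poly_Mapping.keys f \<union> Poly_Mapping.keys h"
  have "lin_ext g (f + h) = (\<Sum>a\<in>?A. pscale (Poly_Mapping.lookup (f + h) a) (g a))"
    using Poly_Mapping.keys_add[of f h] by (intro lin_ext_superset) auto
  then show ?thesis
    by (simp add: lin_ext_superset[of ?A] lookup_add pvec.scale_left_distrib sum.distrib)
qed

lemma lin_ext_scale: "lin_ext g (pscale c f) = pscale c (lin_ext g f)"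
proof -
  have "lin_ext g (pscale c f) =
    (\<Sum>a\<in>Poly_Mapping.keys f. pscale (Poly_Mapping.lookup (pscale c f) a) (g a))"
    by (intro lin_ext_superset) (auto simp: in_keys_iff lookup_pscale)
  then show ?thesis by (simp add: lin_ext_def lookup_pscale pvec.scale_sum_right)
qed

lemma linear_lin_ext: "Vector_Spaces.linear pscale pscale (lin_ext g)"
  by unfold_locales (simp_all add: lin_ext_add lin_ext_scale)

lemma lin_ext_0: "lin_ext g 0 = 0"
  by (simp add: lin_ext_def)

lemma lin_ext_sum: "lin_ext g (\<Sum>i\<in>I. f i) = (\<Sum>i\<in>I. lin_ext g (f i))"
  by (induction I rule: infinite_finite_induct) (simp_all add: lin_ext_0 lin_ext_add)

lemma lin_ext_sum_mset: "lin_ext g (\<Sum>i\<in>#M. f i) = (\<Sum>i\<in>#M. lin_ext g (f i))"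
  by (induction M) (simp_all add: lin_ext_0 lin_ext_add)

lemma lin_ext_basis [simp]: "lin_ext g (basis_elt a) = g a"
  by (simp add: lin_ext_def basis_elt_def)

lemma lin_ext_fun_add: "lin_ext (\<lambda>a. g a + h a) f = lin_ext g f + lin_ext h f"
  by (simp add: lin_ext_def pvec.scale_right_distrib sum.distrib)

lemma lin_ext_fun_scale: "lin_ext (\<lambda>a. pscale c (g a)) f = pscale c (lin_ext g f)"
  by (simp add: lin_ext_def pvec.scale_sum_right mult.commute)

lemma lin_ext_basis_id: "lin_ext basis_elt f = f"
  by (rule poly_mapping_eqI)
    (simp add: lin_ext_def lookup_sum lookup_pscale basis_elt_def lookup_single when_def
      in_keys_iff if_distrib[of "(*) _"] sum.delta cong: if_cong)

text \<open>Reduces a multilinear identity to basis elements, one argument at a time.\<close>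

lemma basis_induct [case_names basis add scale]:
  assumes basis: "\<And>a. Q (basis_elt a)" and add: "\<And>f g. Q f \<Longrightarrow> Q g \<Longrightarrow> Q (f + g)"
    and scale: "\<And>c f. Q f \<Longrightarrow> Q (pscale c f)"
  shows "Q f"
proof -
  have 0: "Q 0" using scale[OF basis, of 0] by simp
  have "Q (lin_ext basis_elt f)"
    unfolding lin_ext_def using Poly_Mapping.finite_keys[of f]
    by (induction rule: finite_induct) (auto intro: 0 add scale basis)
  then show ?thesis by (simp add: lin_ext_basis_id)
qed

lemma pq_mult_add_left: "pq_mult (f + f') g = pq_mult f g + pq_mult f' g"
  by (simp add: pq_mult_def lin_ext_add)

lemma pq_mult_add_right: "pq_mult f (g + g') = pq_mult f g + pq_mult f g'"
  by (simp add: pq_mult_def lin_ext_add lin_ext_fun_add)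

lemma pq_mult_scale_left: "pq_mult (pscale c f) g = pscale c (pq_mult f g)"
  by (simp add: pq_mult_def lin_ext_scale)

lemma pq_mult_scale_right: "pq_mult f (pscale c g) = pscale c (pq_mult f g)"
  by (simp add: pq_mult_def lin_ext_scale lin_ext_fun_scale)

lemma pq_mult_0_left: "pq_mult 0 g = 0"
  by (simp add: pq_mult_def lin_ext_0)

lemma pq_mult_0_right: "pq_mult f 0 = 0"
  using pq_mult_scale_right[of f 0 0] by simp

lemma pq_mult_sum_left: "pq_mult (\<Sum>i\<in>I. f i) g = (\<Sum>i\<in>I. pq_mult (f i) g)"
  by (simp add: pq_mult_def lin_ext_sum)

lemma pq_mult_sum_right: "pq_mult f (\<Sum>i\<in>I. g i) = (\<Sum>i\<in>I. pq_mult f (g i))"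
  by (induction I rule: infinite_finite_induct) (simp_all add: pq_mult_0_right pq_mult_add_right)

lemma pq_mult_sum_mset_left: "pq_mult (\<Sum>i\<in>#I. f i) g = (\<Sum>i\<in>#I. pq_mult (f i) g)"
  by (simp add: pq_mult_def lin_ext_sum_mset)

lemma pq_mult_sum_mset_right: "pq_mult f (\<Sum>i\<in>#I. g i) = (\<Sum>i\<in>#I. pq_mult f (g i))"
  by (induction I) (simp_all add: pq_mult_0_right pq_mult_add_right)

lemma pq_mult_basis: "pq_mult (\<F> a) (\<F> b) = (\<Sum>w\<in>#mshuffles a (cshift (length a) b). \<F> w)"
  by (simp add: pq_mult_def)

section \<open>Shuffles with multiplicity and associativity of the product\<close>

lemma mshuffles_Nil2 [simp]: "mshuffles xs [] = {#xs#}"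
  by (cases xs) auto

lemma length_mshuffles: "w \<in># mshuffles xs ys \<Longrightarrow> length w = length xs + length ys"
  using set_mset_mshuffles[of xs ys] by (auto dest: length_shuffles)

lemma mset_mshuffles: "w \<in># mshuffles xs ys \<Longrightarrow> mset w = mset xs + mset ys"
  using set_mset_mshuffles[of xs ys] by (auto dest: mset_shuffles)

lemma mshuffles_map: "mshuffles (map g xs) (map g ys) = image_mset (map g) (mshuffles xs ys)"
  by (induction xs ys rule: mshuffles.induct) (simp_all add: multiset.map_comp o_def)

lemma image_mset_sum_mset: "image_mset g (\<Sum>i\<in>#M. N i) = (\<Sum>i\<in>#M. image_mset g (N i))"
  by (induction M) simp_all

lemma sum_mset_sum_mset: "(\<Sum>z\<in>#(\<Sum>i\<in>#M. N i). h z) = (\<Sum>i\<in>#M. \<Sum>z\<in>#N i. h z)"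
  by (induction M) simp_all

text \<open>When no word is empty, both sides split into three parts according to which word
  supplies the first letter, and the total length drops by one in each part.\<close>

lemma mshuffles_assoc:
  "(\<Sum>w\<in>#mshuffles xs ys. mshuffles w zs) = (\<Sum>w\<in>#mshuffles ys zs. mshuffles xs w)"
proof (induction "length xs + length ys + length zs" arbitrary: xs ys zs rule: less_induct)
  case less
  show ?case
  proof (cases "xs = [] \<or> ys = [] \<or> zs = []")
    case True
    have "(\<Sum>w\<in>#M. {#w#}) = M" for M :: "'a list multiset" by (induction M) auto
    moreover have "mshuffles [] = (\<lambda>w :: 'a list. {#w#})" by auto
    ultimately show ?thesis using True by auto
  next
    case False
    then obtain x xs' y ys' z zs' where e: "xs = x # xs'" "ys = y # ys'" "zs = z # zs'"
      by (metis neq_Nil_conv)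
    let ?L = "\<lambda>xs ys zs. \<Sum>w\<in>#mshuffles xs ys. mshuffles w zs"
    let ?R = "\<lambda>xs ys zs. \<Sum>w\<in>#mshuffles ys zs. mshuffles xs w"
    have "?L xs ys zs = image_mset ((#) x) (?L xs' ys zs) + image_mset ((#) y) (?L xs ys' zs)
        + image_mset ((#) z) (?L xs ys zs')"
      by (simp add: e image_mset_sum_mset multiset.map_comp o_def sum_mset.distrib)
    moreover have "?R xs ys zs = image_mset ((#) x) (?R xs' ys zs) + image_mset ((#) y) (?R xs ys' zs)
        + image_mset ((#) z) (?R xs ys zs')"
      by (simp add: e image_mset_sum_mset multiset.map_comp o_def sum_mset.distrib)
    moreover have "?L xs' ys zs = ?R xs' ys zs" "?L xs ys' zs = ?R xs ys' zs"
      "?L xs ys zs' = ?R xs ys zs'"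
      by (rule less; simp add: e)+
    ultimately show ?thesis by simp
  qed
qed

lemma cshift_cshift: "cshift k (cshift l w) = cshift (k + l) w"
  by (simp add: cshift_def o_def case_prod_unfold add.assoc add.commute add.left_commute)

lemma mshuffles_cshift:
  "mshuffles (cshift k xs) (cshift k ys) = image_mset (cshift k) (mshuffles xs ys)"
proof -
  have "cshift k = map (\<lambda>(x, c). (x + k, c))" by (rule ext) (simp add: cshift_def)
  then show ?thesis by (simp only: mshuffles_map)
qed

lemma length_cshift [simp]: "length (cshift k w) = length w"
  by (simp add: cshift_def)

lemma pq_mult_assoc: "pq_mult (pq_mult f g) h = pq_mult f (pq_mult g h)"
proof (induction f rule: basis_induct)
  case (basis a)
  show ?case
  proof (induction g rule: basis_induct)
    case (basis b)
    show ?case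
    proof (induction h rule: basis_induct)
      case (basis c)
      let ?a = "length a" and ?b = "length b"
      \<comment> \<open>Every shuffle of \<open>a\<close> with the shifted \<open>b\<close> has
        length \<open>?a + ?b\<close>, so \<open>c\<close> is shifted by the same amount in all
        terms.\<close>
      have "pq_mult (pq_mult (\<F> a) (\<F> b)) (\<F> c) =
        (\<Sum>w\<in>#mshuffles a (cshift ?a b). \<Sum>z\<in>#mshuffles w (cshift (?a + ?b) c). \<F> z)"
        unfolding pq_mult_basis pq_mult_sum_mset_left
        by (intro arg_cong[of _ _ sum_mset] image_mset_cong) (simp add: length_mshuffles)
      also have "\<dots> = (\<Sum>z\<in>#(\<Sum>w\<in>#mshuffles (cshift ?a b) (cshift (?a + ?b) c). mshuffles a w). \<F> z)"
        unfolding sum_mset_sum_mset[symmetric] mshuffles_assoc ..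
      also have "mshuffles (cshift ?a b) (cshift (?a + ?b) c)
        = image_mset (cshift ?a) (mshuffles b (cshift ?b c))"
        unfolding cshift_cshift[symmetric] by (rule mshuffles_cshift)
      also have "(\<Sum>z\<in>#(\<Sum>w\<in>#\<dots>. mshuffles a w). \<F> z) = pq_mult (\<F> a) (pq_mult (\<F> b) (\<F> c))"
        by (simp add: pq_mult_basis pq_mult_sum_mset_right sum_mset_sum_mset multiset.map_comp o_def)
      finally show ?case .
    qed (simp_all add: pq_mult_add_right pq_mult_scale_right)
  qed (simp_all add: pq_mult_add_right pq_mult_scale_right pq_mult_add_left pq_mult_scale_left)
qed (simp_all add: pq_mult_add_left pq_mult_scale_left)

lemma pq_mult_one_left: "pq_mult pq_one f = f"
proof (induction f rule: basis_induct)
  case (basis a)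
  have "cshift 0 a = a" by (simp add: cshift_def)
  then show ?case by (simp add: pq_one_def pq_mult_basis)
qed (simp_all add: pq_mult_add_right pq_mult_scale_right)

lemma pq_mult_one_right: "pq_mult f pq_one = f"
proof (induction f rule: basis_induct)
  case (basis a)
  show ?case by (simp add: pq_one_def pq_mult_basis cshift_def)
qed (simp_all add: pq_mult_add_left pq_mult_scale_left)

text \<open>The words are cut without parkization, which makes associativity immediate; parkization enters
  only through functions that are constant on parkization classes.\<close>

definition wconv :: "(cword \<Rightarrow> pq) \<Rightarrow> (cword \<Rightarrow> pq) \<Rightarrow> cword \<Rightarrow> pq" where
  "wconv f g w = (\<Sum>i\<le>length w. pq_mult (f (take i w)) (g (drop i w)))"

definition weps :: "cword \<Rightarrow> pq" where
  "weps w = (if w = [] then pq_one else 0)"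

lemma wconv_assoc: "wconv (wconv f g) h = wconv f (wconv g h)"
proof
  fix w :: cword
  let ?n = "length w"
  let ?t = "\<lambda>i j. pq_mult (f (take j w)) (pq_mult (g (take (i - j) (drop j w))) (h (drop i w)))"
  have "wconv (wconv f g) h w = (\<Sum>i\<le>?n. \<Sum>j\<le>i. ?t i j)"
    unfolding wconv_def pq_mult_sum_left
    by (intro sum.cong) (auto simp: pq_mult_assoc min_def drop_take)
  also have "\<dots> = (\<Sum>(i,j)\<in>(SIGMA i:{..?n}. {..i}). ?t i j)"
    by (rule sum.Sigma) auto
  \<comment> \<open>Both sides run over the ways to cut \<open>w\<close> twice: \<open>j\<close> is
    the first cut, \<open>i\<close> the second, and \<open>k = i - j\<close> the length of the
    middle factor.\<close>
  also have "\<dots> = (\<Sum>(j,k)\<in>(SIGMA j:{..?n}. {..?n - j}). ?t (k + j) j)"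
    by (rule sum.reindex_bij_witness[of _ "\<lambda>(j,k). (k + j, j)" "\<lambda>(i,j). (j, i - j)"]) auto
  also have "\<dots> = (\<Sum>j\<le>?n. \<Sum>k\<le>?n - j. ?t (k + j) j)"
    by (rule sum.Sigma[symmetric]) auto
  also have "\<dots> = wconv f (wconv g h) w"
    unfolding wconv_def pq_mult_sum_right by (simp add: add.commute)
  finally show "wconv (wconv f g) h w = wconv f (wconv g h) w" .
qed

lemma wconv_weps: "wconv weps f = f"
proof
  fix w
  have "wconv weps f w = (\<Sum>i\<le>length w. if i = 0 then f w else 0)"
    unfolding wconv_def
    by (intro sum.cong refl) (auto simp: weps_def pq_mult_one_left pq_mult_0_left)
  then show "wconv weps f w = f w" by (simp add: sum.delta')
qed

text \<open>A left inverse is a right inverse: with \<open>r = g * f\<close> one has \<open>f * r = f\<close>, and this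
  determines \<open>r\<close> recursively.\<close>

lemma wconv_inverse:
  assumes "wconv f g = weps" "f [] = pq_one"
  shows "wconv g f = weps"
proof
  fix w
  define r where "r = wconv g f"
  have fr: "wconv f r = f" by (simp add: r_def wconv_assoc[symmetric] assms(1) wconv_weps)
  show "wconv g f w = weps w"
    unfolding r_def[symmetric]
  proof (induction w rule: length_induct)
    case (1 w)
    \<comment> \<open>The term \<open>i = 0\<close> is \<open>r w\<close>, since \<open>f []\<close>
      is the unit; the other terms contain \<open>r\<close> only on proper suffixes.\<close>
    have split: "{..length w} = insert 0 {0<..length w}" by auto
    have "f w = wconv f r w" by (simp add: fr)
    also have "\<dots> = r w + (\<Sum>i\<in>{0<..length w}. pq_mult (f (take i w)) (r (drop i w)))"
      unfolding wconv_def split by (simp add: assms(2) pq_mult_one_left)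
    also have "(\<Sum>i\<in>{0<..length w}. pq_mult (f (take i w)) (r (drop i w))) =
      (\<Sum>i\<in>{0<..length w}. if i = length w then f w else 0)"
    proof (rule sum.cong)
      fix i assume i: "i \<in> {0<..length w}"
      then have "r (drop i w) = weps (drop i w)" by (intro 1[rule_format]) (use i in auto)
      then show "pq_mult (f (take i w)) (r (drop i w)) = (if i = length w then f w else 0)"
        using i by (auto simp: weps_def pq_mult_one_right pq_mult_0_right)
    qed simp
    \<comment> \<open>Of the remaining terms only \<open>i = length w\<close> survives; for the
      empty word this index is outside the range.\<close>
    finally have "f w = r w + (if w = [] then 0 else f w)" by (auto simp: sum.delta')
    then show ?case using assms(2) by (auto simp: weps_def)
  qed
qed

section \<open>The antipode\<close>

lemma length_park [simp]: "length (park w) = length w"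
  by (induction w rule: park_induct) (subst park_skip, simp)

lemma length_cpark [simp]: "length (cpark w) = length w"
  by (simp add: cpark_def)

lemma cpark_Nil [simp]: "cpark [] = []"
  by (simp add: cpark_def)

lemma map_fst_map_prod [simp]: "map fst (map (map_prod f id) w) = map f (map fst w)"
  by (induction w) auto

lemma map_snd_map_prod [simp]: "map snd (map (map_prod f id) w) = map snd w"
  by (induction w) auto

lemma zip_map_fst: "zip (map f (map fst w)) (map snd w) = map (map_prod f id) w"
  by (induction w) auto

text \<open>Parkization relabels values letter by letter, so the colors are carried along and
  \<open>park_letter_map\<close> lifts through \<open>map_prod f id\<close>.\<close>

lemma cpark_letter_map:
  assumes "0 \<notin> fst ` set w"
  obtains f where "strict_mono_on (fst ` set w) f"
    and "\<And>w'. mset w' = mset w \<Longrightarrow> cpark w' = map (map_prod f id) w'"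
    and "\<And>b. tight b (map fst w) \<Longrightarrow>
      \<exists>b'. tight b' (map fst (cpark w)) \<and> (\<forall>x\<in>fst ` set w. f x \<le> b' \<longleftrightarrow> x \<le> b)"
    and "\<And>v. mset v \<subseteq># mset w \<Longrightarrow> cpark (map (map_prod f id) v) = cpark v"
    and "cpf (cpark w)"
proof -
  have 0: "0 \<notin> set (map fst w)" using assms by simp
  obtain f where f: "strict_mono_on (set (map fst w)) f"
    "\<And>w'. mset w' = mset (map fst w) \<Longrightarrow> park w' = map f w'"
    "\<And>b. tight b (map fst w) \<Longrightarrow>
      \<exists>b'. tight b' (map f (map fst w)) \<and> (\<forall>x\<in>set (map fst w). f x \<le> b' \<longleftrightarrow> x \<le> b)"
    "\<And>v. mset v \<subseteq># mset (map fst w) \<Longrightarrow> park (map f v) = park v"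
    "parking_function (map f (map fst w))"
    using park_letter_map[OF 0] by metis
  have c: "cpark w' = map (map_prod f id) w'" if "mset w' = mset w" for w'
  proof -
    have "park (map fst w') = map f (map fst w')" using that by (intro f(2)) simp
    then show ?thesis by (simp only: cpark_def zip_map_fst)
  qed
  have d: "map fst (cpark w) = map f (map fst w)" by (simp only: c map_fst_map_prod)
  show thesis
  proof (rule that[of f])
    show "cpark w' = map (map_prod f id) w'" if "mset w' = mset w" for w'
      using that by (rule c)
    show "strict_mono_on (fst ` set w) f" using f(1) by simp
    show "\<exists>b'. tight b' (map fst (cpark w)) \<and> (\<forall>x\<in>fst ` set w. f x \<le> b' \<longleftrightarrow> x \<le> b)"
      if "tight b (map fst w)" for b
      using f(3)[OF that] unfolding d by simp
    show "cpark (map (map_prod f id) v) = cpark v" if "mset v \<subseteq># mset w" for v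
      unfolding cpark_def map_fst_map_prod map_snd_map_prod
      using that by (subst f(4)) (simp_all add: image_mset_subseteq_mono)
    show "cpf (cpark w)" unfolding cpf_def d by (rule f(5))
  qed
qed

lemma mset_take_subseteq: "mset (take i w) \<subseteq># mset w"
  by (metis append_take_drop_id mset_append mset_subset_eq_add_left)

lemma mset_drop_subseteq: "mset (drop i w) \<subseteq># mset w"
  by (metis append_take_drop_id mset_append mset_subset_eq_add_right)

lemma cpf_pos: "cpf w \<Longrightarrow> 0 \<notin> fst ` set w"
  by (simp add: cpf_def parking_function_iff)

lemma cpf_cpark: "0 \<notin> fst ` set w \<Longrightarrow> cpf (cpark w)"
  by (rule cpark_letter_map) auto

text \<open>Prefixes commute with the letterwise relabelling, which leaves the parkization of a
  submultiset unchanged.\<close>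

lemma cpark_take: "0 \<notin> fst ` set w \<Longrightarrow> cpark (take i (cpark w)) = cpark (take i w)"
  by (rule cpark_letter_map[of w]) (auto simp: take_map mset_take_subseteq)

lemma cpark_drop: "0 \<notin> fst ` set w \<Longrightarrow> cpark (drop i (cpark w)) = cpark (drop i w)"
  by (rule cpark_letter_map[of w]) (auto simp: drop_map mset_drop_subseteq)

lemma cpf_cong: "mset v = mset w \<Longrightarrow> cpf v \<longleftrightarrow> cpf w"
  unfolding cpf_def by (rule parking_function_cong) simp

lemma letters_le_append: "letters_le i (v @ w) = letters_le i v + letters_le i w"
  by (simp add: letters_le_filter)

lemma letters_le_shift: "letters_le i (map (\<lambda>x. x + k) w) = (if k \<le> i then letters_le (i - k) w else 0)"
  by (induction w) (auto simp: letters_le_filter)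

lemma map_fst_cshift [simp]: "map fst (cshift k w) = map (\<lambda>x. x + k) (map fst w)"
  by (induction w) (auto simp: cshift_def)

text \<open>Up to \<open>length a\<close> the letters of \<open>a\<close> suffice; beyond that, all
  of \<open>a\<close> is counted and the shifted \<open>b\<close> provides the rest.\<close>

lemma cpf_bullet:
  assumes "cpf a" "cpf b" shows "cpf (a \<bullet>\<^sub>c b)"
proof -
  let ?a = "map fst a" and ?b = "map fst b"
  have a: "0 \<notin> set ?a" "i \<le> length a \<Longrightarrow> i \<le> letters_le i ?a" for i
    using assms(1) by (auto simp: cpf_def parking_function_iff)
  have b: "0 \<notin> set ?b" "i \<le> length b \<Longrightarrow> i \<le> letters_le i ?b" for i
    using assms(2) by (auto simp: cpf_def parking_function_iff)
  have "i \<le> letters_le i (?a @ map (\<lambda>x. x + length a) ?b)" if "i \<le> length a + length b" for i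
  proof (cases "i \<le> length a")
    case True
    then show ?thesis using a(2)[of i] by (simp add: letters_le_append)
  next
    case False
    have "length a \<le> letters_le i ?a"
      using a(2)[of "length a"] letters_le_cnt[of "length a" i ?a] False by simp
    moreover have "i - length a \<le> letters_le (i - length a) ?b"
      using that by (intro b(2)) simp
    ultimately show ?thesis
      using False unfolding letters_le_append letters_le_shift by simp
  qed
  moreover have "0 \<notin> set (?a @ map (\<lambda>x. x + length a) ?b)"
    using a(1) b(1) by (force simp: image_iff)
  ultimately show ?thesis
    by (simp add: cpf_def cbullet_def parking_function_iff del: map_map)
qed

lemma PQSym2_basis: "cpf a \<Longrightarrow> \<F> a \<in> PQSym2"
  unfolding PQSym2_def by (rule pvec.span_base) simp

lemma subspace_PQSym2: "pvec.subspace PQSym2"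
  unfolding PQSym2_def by (rule pvec.subspace_span)

text \<open>Bilinearity: the second factor is extended to the span for each fixed generator, then
  the first.\<close>

lemma pq_mult_span_closed:
  assumes "\<And>x y. x \<in> X \<Longrightarrow> y \<in> Y \<Longrightarrow> pq_mult x y \<in> H" "pvec.subspace H"
    and "f \<in> pvec.span X" "g \<in> pvec.span Y"
  shows "pq_mult f g \<in> H"
proof -
  note H = pvec.subspace_0[OF assms(2)] pvec.subspace_add[OF assms(2)]
    pvec.subspace_scale[OF assms(2)]
  have "pvec.span Y \<subseteq> {g. pq_mult x g \<in> H}" if "x \<in> X" for x
    by (rule pvec.span_minimal)
      (auto intro!: pvec.subspaceI H
        simp: assms(1)[OF that] pq_mult_0_right pq_mult_add_right pq_mult_scale_right)
  then have "X \<subseteq> {f. pq_mult f g \<in> H}" using assms(4) by blast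
  then have "pvec.span X \<subseteq> {f. pq_mult f g \<in> H}"
    by (rule pvec.span_minimal)
      (auto intro!: pvec.subspaceI H
        simp: pq_mult_0_left pq_mult_add_left pq_mult_scale_left)
  then show ?thesis using assms(3) by blast
qed

lemma subspace_sum_mset:
  "pvec.subspace H \<Longrightarrow> (\<And>i. i \<in># M \<Longrightarrow> f i \<in> H) \<Longrightarrow> (\<Sum>i\<in>#M. f i) \<in> H"
  by (induction M) (auto intro: pvec.subspace_0 pvec.subspace_add)

text \<open>Each shuffle is a rearrangement of the shifted concatenation, and \<open>cpf\<close>
  depends only on the multiset of letters.\<close>

lemma PQSym2_mult: "f \<in> PQSym2 \<Longrightarrow> g \<in> PQSym2 \<Longrightarrow> pq_mult f g \<in> PQSym2"
proof (rule pq_mult_span_closed[OF _ subspace_PQSym2])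
  fix x y assume "x \<in> \<F> ` Collect cpf" "y \<in> \<F> ` Collect cpf"
  then obtain a b where ab: "x = \<F> a" "y = \<F> b" "cpf a" "cpf b" by auto
  have "cpf w" if "w \<in># mshuffles a (cshift (length a) b)" for w
    using cpf_cong[of w "a \<bullet>\<^sub>c b"] mset_mshuffles[OF that] cpf_bullet[OF ab(3,4)]
    by (simp add: cbullet_def)
  then show "pq_mult x y \<in> PQSym2"
    unfolding ab(1,2) pq_mult_basis by (intro subspace_sum_mset subspace_PQSym2 PQSym2_basis)
qed (auto simp: PQSym2_def)

lemma PQSym2_one: "pq_one \<in> PQSym2"
  unfolding pq_one_def by (rule PQSym2_basis) (simp add: cpf_def parking_function_def)

text \<open>The recursion solves the left inverse equation under \<open>wconv\<close> for the term
  with empty right factor. The left argument is cut without parkization, so that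
  \<open>wconv_assoc\<close> applies.\<close>

function antipode_word :: "cword \<Rightarrow> pq" where
  "antipode_word w = (if w = [] then pq_one
     else - (\<Sum>i<length w. pq_mult (antipode_word (take i w)) (\<F> (cpark (drop i w)))))"
  by pat_completeness auto
termination by (relation "measure length") auto

declare antipode_word.simps [simp del]

lemma antipode_word_Nil [simp]: "antipode_word [] = pq_one"
  by (simp add: antipode_word.simps)

lemma wconv_antipode_left: "wconv antipode_word (\<lambda>w. \<F> (cpark w)) = weps"
proof
  fix w
  show "wconv antipode_word (\<lambda>w. \<F> (cpark w)) w = weps w"
  proof (cases "w = []")
    case False
    have "{..length w} = insert (length w) {..<length w}" by auto
    then show ?thesis
      using False antipode_word.simps[of w]
      by (simp add: wconv_def weps_def pq_mult_one_right flip: pq_one_def)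
  qed (simp add: wconv_def weps_def pq_mult_one_left flip: pq_one_def)
qed

lemma wconv_antipode_right: "wconv (\<lambda>w. \<F> (cpark w)) antipode_word = weps"
  using wconv_antipode_left by (rule wconv_inverse) simp

text \<open>Constancy on parkization classes lets the parkized factors in \<open>pq_comult\<close>
  be replaced by the raw factors of \<open>wconv\<close>.\<close>

lemma antipode_word_cpark:
  assumes "0 \<notin> fst ` set w" shows "antipode_word (cpark w) = antipode_word w"
  using assms
proof (induction w rule: length_induct)
  case (1 w)
  \<comment> \<open>The prefixes of \<open>w\<close> and of \<open>cpark w\<close> have the same
    parkization; the induction hypothesis is applied to each of them.\<close>
  have *: "antipode_word (take i (cpark w)) = antipode_word (take i w)" if i: "i < length w" for i
  proof -
    have p: "0 \<notin> fst ` set (take i w)" "0 \<notin> fst ` set (take i (cpark w))"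
      using 1(2) cpf_pos[OF cpf_cpark[OF 1(2)]] by (auto dest: in_set_takeD)
    have "antipode_word (take i (cpark w)) = antipode_word (cpark (take i (cpark w)))"
      using i by (intro 1(1)[rule_format, OF _ p(2), symmetric]) simp
    also have "\<dots> = antipode_word (take i w)"
      using i by (subst cpark_take[OF 1(2)], intro 1(1)[rule_format, OF _ p(1)]) simp
    finally show ?thesis .
  qed
  have "cpark w = [] \<longleftrightarrow> w = []" by (metis length_0_conv length_cpark)
  then show ?case
    by (subst (1 2) antipode_word.simps) (simp add: * cpark_drop[OF 1(2)])
qed

lemma antipode_word_PQSym2: "0 \<notin> fst ` set w \<Longrightarrow> antipode_word w \<in> PQSym2"
proof (induction w rule: length_induct)
  case (1 w)
  have "pq_mult (antipode_word (take i w)) (\<F> (cpark (drop i w))) \<in> PQSym2"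
    if "i < length w" for i
  proof (rule PQSym2_mult)
    show "antipode_word (take i w) \<in> PQSym2"
      using 1(2) that by (intro 1(1)[rule_format]) (auto dest: in_set_takeD)
    show "\<F> (cpark (drop i w)) \<in> PQSym2"
      using 1(2) by (intro PQSym2_basis cpf_cpark) (auto dest: in_set_dropD)
  qed
  then show ?case
    by (subst antipode_word.simps)
      (auto intro!: PQSym2_one pvec.subspace_neg pvec.subspace_sum subspace_PQSym2)
qed

lemma pq_antipode_lin_ext: "pq_antipode (lin_ext antipode_word)"
proof -
  let ?S = "lin_ext antipode_word"
  have "PQSym2 \<subseteq> {f. ?S f \<in> PQSym2}"
    unfolding PQSym2_def
    by (rule pvec.span_minimal)
      (auto intro!: pvec.subspaceI antipode_word_PQSym2[unfolded PQSym2_def] cpf_pos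
        intro: pvec.span_add pvec.span_scale pvec.span_zero
        simp: lin_ext_add lin_ext_scale lin_ext_0 image_image)
  moreover have "PQSym2 \<subseteq> {f. pq_convolution ?S id f = pscale (pq_counit f) pq_one \<and>
      pq_convolution id ?S f = pscale (pq_counit f) pq_one}"
    unfolding PQSym2_def
  proof (rule pvec.span_minimal)
    have "pq_convolution ?S id (\<F> a) = pscale (pq_counit (\<F> a)) pq_one \<and>
      pq_convolution id ?S (\<F> a) = pscale (pq_counit (\<F> a)) pq_one" if "cpf a" for a
    proof -
      have p: "0 \<notin> fst ` set (take i a)" "0 \<notin> fst ` set (drop i a)" for i
        using cpf_pos[OF that] by (auto dest: in_set_takeD in_set_dropD)
      have e: "weps a = pscale (pq_counit (\<F> a)) pq_one"
        by (simp add: weps_def pq_counit_def basis_elt_def lookup_single when_def)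
      \<comment> \<open>On a basis word the convolution of \<open>PQSym2\<close> becomes
        \<open>wconv\<close>, after parkization is dropped inside the antipode.\<close>
      have "pq_convolution ?S id (\<F> a) = wconv antipode_word (\<lambda>w. \<F> (cpark w)) a"
        by (simp add: pq_convolution_def pq_comult_def lin_ext_sum wconv_def
            antipode_word_cpark[OF p(1)])
      moreover have "pq_convolution id ?S (\<F> a) = wconv (\<lambda>w. \<F> (cpark w)) antipode_word a"
        by (simp add: pq_convolution_def pq_comult_def lin_ext_sum wconv_def
            antipode_word_cpark[OF p(2)])
      ultimately show ?thesis by (simp add: wconv_antipode_left wconv_antipode_right e)
    qed
    then show "\<F> ` Collect cpf \<subseteq> {f. pq_convolution ?S id f = pscale (pq_counit f) pq_one \<and>
      pq_convolution id ?S f = pscale (pq_counit f) pq_one}" by auto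
    show "pvec.subspace {f. pq_convolution ?S id f = pscale (pq_counit f) pq_one \<and>
      pq_convolution id ?S f = pscale (pq_counit f) pq_one}"
      by (rule pvec.subspaceI)
        (auto simp: pq_convolution_def pq_comult_def lin_ext_0 lin_ext_add lin_ext_scale
          pq_counit_def lookup_add lookup_pscale pvec.scale_left_distrib)
  qed
  ultimately show ?thesis
    unfolding pq_antipode_def using linear_lin_ext[of antipode_word] by blast
qed

section \<open>Signed parking functions without prime factorizations\<close>

text \<open>For equal values no \<open>b\<close> meets both bounds, so equal values must carry equal
  colors. Order plays no part in the condition, which therefore lives on multisets.\<close>

definition separated :: "cword \<Rightarrow> bool" where
  "separated w \<longleftrightarrow> (\<forall>p\<in>set w. \<forall>q\<in>set w. snd p \<noteq> snd q \<longrightarrow> fst p \<le> fst q \<longrightarrow>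
    (\<exists>b. fst p \<le> b \<and> b < fst q \<and> tight b (map fst w)))"

lemma separated_mono:
  assumes "mset v \<subseteq># mset w" "separated w" shows "separated v"
proof -
  have "mset (map fst v) \<subseteq># mset (map fst w)" using assms(1) by (simp add: image_mset_subseteq_mono)
  moreover have "set v \<subseteq> set w" using set_mset_mono[OF assms(1)] by simp
  ultimately show ?thesis using assms(2) unfolding separated_def by (meson subsetD tight_mono)
qed

lemma separated_inj: "separated w \<Longrightarrow> inj_on fst (set w)"
proof (rule inj_onI)
  fix p q assume "separated w" "p \<in> set w" "q \<in> set w" "fst p = fst q"
  then have "snd p = snd q" unfolding separated_def by force
  then show "p = q" using \<open>fst p = fst q\<close> by (rule prod_eqI[rotated])
qed

text \<open>The relabelling reflects the order of values, and a separating \<open>b\<close> is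
  carried to the \<open>b'\<close> given by \<open>cpark_letter_map\<close>.\<close>

lemma separated_cpark:
  assumes "0 \<notin> fst ` set w" "separated w" shows "separated (cpark w)"
proof -
  obtain f where f: "strict_mono_on (fst ` set w) f"
    "\<And>w'. mset w' = mset w \<Longrightarrow> cpark w' = map (map_prod f id) w'"
    "\<And>b. tight b (map fst w) \<Longrightarrow>
      \<exists>b'. tight b' (map fst (cpark w)) \<and> (\<forall>x\<in>fst ` set w. f x \<le> b' \<longleftrightarrow> x \<le> b)"
    using cpark_letter_map[OF assms(1)] by metis
  show ?thesis
    unfolding separated_def
  proof (intro ballI impI)
    fix p' q' assume m: "p' \<in> set (cpark w)" "q' \<in> set (cpark w)"
      and pq': "snd p' \<noteq> snd q'" "fst p' \<le> fst q'"
    have *: "\<exists>p\<in>set w. p' = map_prod f id p" if "p' \<in> set (cpark w)" for p'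
      using that by (simp only: f(2)[OF refl] set_map image_iff)
    obtain p where p: "p \<in> set w" "p' = map_prod f id p" using *[OF m(1)] ..
    obtain q where q: "q \<in> set w" "q' = map_prod f id q" using *[OF m(2)] ..
    note pq = p(1) q(1) p(2) q(2)
    have "fst p \<le> fst q"
    proof (rule ccontr)
      assume "\<not> fst p \<le> fst q"
      then have "f (fst q) < f (fst p)" using pq by (intro strict_mono_onD[OF f(1)]) auto
      then show False using pq pq' by simp
    qed
    then obtain b where b: "fst p \<le> b" "b < fst q" "tight b (map fst w)"
      using assms(2) pq pq' unfolding separated_def by auto
    obtain b' where b': "tight b' (map fst (cpark w))" "\<forall>x\<in>fst ` set w. f x \<le> b' \<longleftrightarrow> x \<le> b"
      using f(3)[OF b(3)] by blast
    have "f (fst p) \<le> b'" "\<not> f (fst q) \<le> b'" using b' b pq by auto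
    then show "\<exists>b. fst p' \<le> b \<and> b < fst q' \<and> tight b (map fst (cpark w))"
      using b'(1) pq by (intro exI[of _ b']) simp
  qed
qed

section \<open>Separation under shifted concatenation\<close>

lemma cnt_append: "cnt c b (v @ w) = cnt c b v + cnt c b w"
  by (simp add: cnt_def)

lemma cpf_le: "cpf w \<Longrightarrow> p \<in> set w \<Longrightarrow> fst p \<le> length w"
  by (force simp: cpf_def parking_function_def)

text \<open>Of the \<open>b\<close> letters up to \<open>b\<close>, at least \<open>c\<close> are at
  most \<open>c\<close>. This is how an end of a prime factor yields the bound in
  \<open>tight b\<close>.\<close>

lemma cpf_cnt:
  assumes "cpf w" "c \<le> b" "b \<le> length w" "letters_le b (map fst w) = b"
  shows "cnt c b (map fst w) \<le> b - c"
proof -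
  have "c \<le> letters_le c (map fst w)"
    using assms by (simp add: cpf_def parking_function_iff)
  then show ?thesis using letters_le_cnt[of c b "map fst w"] assms by simp
qed

lemma letters_le_all: "(\<And>x. x \<in> set w \<Longrightarrow> x \<le> b) \<Longrightarrow> letters_le b w = length w"
  by (simp add: letters_le_filter)

lemma cnt_none: "(\<And>x. x \<in> set w \<Longrightarrow> x \<le> c \<or> b < x) \<Longrightarrow> cnt c b w = 0"
  by (force simp: cnt_def filter_empty_conv)

lemma cnt_shift_ge: "k \<le> c \<Longrightarrow> cnt c b (map (\<lambda>x. x + k) w) = cnt (c - k) (b - k) w"
  by (induction w) (auto simp: cnt_def)

text \<open>A letter of \<open>v\<close> and one of \<open>w\<close> are separated by the length of
  \<open>v\<close>; two letters of the same factor keep their separator, shifted in the case of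
  \<open>w\<close>.\<close>

lemma separated_bullet:
  assumes v: "cpf v" "separated v" and w: "cpf w" "separated w"
  shows "separated (v \<bullet>\<^sub>c w)"
proof -
  let ?k = "length v"
  have v_le: "x \<le> ?k" if "x \<in> set (map fst v)" for x using cpf_le[OF v(1)] that by auto
  have w_gt: "?k < x" if "x \<in> set (map (\<lambda>x. x + ?k) (map fst w))" for x
    using cpf_pos[OF w(1)] that by (auto simp: image_iff intro: gr0I)
  have e: "map fst (v \<bullet>\<^sub>c w) = map fst v @ map (\<lambda>x. x + ?k) (map fst w)"
    by (simp add: cbullet_def)
  have low: "cnt c b (map fst (v \<bullet>\<^sub>c w)) = cnt c b (map fst v)" if "b \<le> ?k" for c b
    unfolding e cnt_append
    using cnt_none[of "map (\<lambda>x. x + ?k) (map fst w)" c b] w_gt that by fastforce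
  have high: "cnt c b (map fst (v \<bullet>\<^sub>c w)) = cnt (c - ?k) (b - ?k) (map fst w)" if "?k \<le> c" for c b
    unfolding e cnt_append cnt_shift_ge[OF that]
    using cnt_none[of "map fst v" c b] v_le that by fastforce
  have k: "cnt c ?k (map fst v) \<le> ?k - c" if "c \<le> ?k" for c
    using that letters_le_all[of "map fst v" ?k, OF v_le] by (intro cpf_cnt[OF v(1)]) simp_all
  have tk: "tight ?k (map fst (v \<bullet>\<^sub>c w))" using k by (simp add: tight_def low)
  have tl: "tight b (map fst (v \<bullet>\<^sub>c w))" if "b \<le> ?k" "tight b (map fst v)" for b
    using that by (simp add: tight_def low)
  have th: "tight (b + ?k) (map fst (v \<bullet>\<^sub>c w))" if "tight b (map fst w)" for b
    unfolding tight_def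
  proof (intro allI impI)
    fix c assume c: "c \<le> b + ?k"
    show "cnt c (b + ?k) (map fst (v \<bullet>\<^sub>c w)) \<le> b + ?k - c"
    proof (cases "?k \<le> c")
      case True
      have "cnt (c - ?k) b (map fst w) \<le> b - (c - ?k)"
        using that c by (simp add: tight_def)
      then show ?thesis using True c by (simp add: high)
    next
      case False
      \<comment> \<open>An interval starting inside the range of \<open>v\<close> is split at
        \<open>?k\<close>, and the bounds of the two pieces add.\<close>
      have "cnt 0 b (map fst w) \<le> b" using that by (auto simp: tight_def)
      then show ?thesis using False k[of c] cnt_split[of c ?k "b + ?k" "map fst (v \<bullet>\<^sub>c w)"]
        by (simp add: high low)
    qed
  qed
  show ?thesis
    unfolding separated_def
  proof (intro ballI impI)
    fix p q assume pq: "p \<in> set (v \<bullet>\<^sub>c w)" "q \<in> set (v \<bullet>\<^sub>c w)" "snd p \<noteq> snd q" "fst p \<le> fst q"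
    have s: "x \<in> set v \<and> fst x \<le> ?k \<or>
      (\<exists>y\<in>set w. fst x = fst y + ?k \<and> snd x = snd y \<and> ?k < fst x)"
      if x: "x \<in> set (v \<bullet>\<^sub>c w)" for x
    proof (cases "x \<in> set v")
      case False
      then obtain y where "y \<in> set w" "x = (fst y + ?k, snd y)"
        using x by (auto simp: cbullet_def cshift_def)
      then show ?thesis using cpf_pos[OF w(1)] by (intro disjI2 bexI[of _ y]) (auto intro!: gr0I)
    qed (use cpf_le[OF v(1)] in simp)
    consider "p \<in> set v" "q \<in> set v" "fst q \<le> ?k" | "fst p \<le> ?k" "?k < fst q"
      | "?k < fst p" "fst q \<le> ?k"
      | p' q' where "p' \<in> set w" "q' \<in> set w" "fst p = fst p' + ?k" "fst q = fst q' + ?k"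
          "snd p = snd p'" "snd q = snd q'"
      using s[OF pq(1)] s[OF pq(2)] by blast
    then show "\<exists>b. fst p \<le> b \<and> b < fst q \<and> tight b (map fst (v \<bullet>\<^sub>c w))"
    proof cases
      case 1
      then obtain b where "fst p \<le> b" "b < fst q" "tight b (map fst v)"
        using v(2) pq unfolding separated_def by blast
      then show ?thesis using tl[of b] 1 by auto
    next
      case 2
      then show ?thesis using tk by blast
    next
      case 3
      then show ?thesis using pq(4) by simp
    next
      case (4 p' q')
      then obtain b where "fst p' \<le> b" "b < fst q'" "tight b (map fst w)"
        using w(2) pq unfolding separated_def by (metis add_le_cancel_right)
      then show ?thesis using th[of b] 4 by (intro exI[of _ "b + ?k"]) simp
    qed
  qed
qed

text \<open>These are the elements of \<open>ndspf\<close>: the end of a prime factor separates any two letters of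
  different colors.\<close>

definition nd_signed :: "cword \<Rightarrow> bool" where
  "nd_signed w \<longleftrightarrow> sorted (map fst w) \<and> cpf w \<and> separated w"

lemma nd_signed_Nil: "nd_signed []"
  by (simp add: nd_signed_def cpf_def parking_function_def separated_def)

lemma nd_signed_bullet:
  assumes "nd_signed v" "nd_signed w" shows "nd_signed (v \<bullet>\<^sub>c w)"
proof -
  have "sorted (map (\<lambda>x. x + length v) (map fst w))"
    using assms(2) by (auto simp: nd_signed_def sorted_wrt_map)
  moreover have "x \<le> length v" if "x \<in> set (map fst v)" for x
    using that assms(1) cpf_le[of v] by (auto simp: nd_signed_def)
  ultimately have "sorted (map fst (v \<bullet>\<^sub>c w))"
    using assms(1) by (fastforce simp: cbullet_def sorted_append nd_signed_def simp del: map_map)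
  then show ?thesis
    using assms by (simp add: nd_signed_def cpf_bullet separated_bullet)
qed

text \<open>A prime block has one color, so it is separated vacuously;
  \<open>nd_signed_bullet\<close> assembles the blocks.\<close>

lemma ndspf_nd_signed:
  assumes "w \<in> ndspf" shows "nd_signed w"
proof -
  obtain bs where w: "w = foldr (\<bullet>\<^sub>c) (map (\<lambda>(b, c). map (\<lambda>x. (x, c)) b) bs) []"
    and bs: "\<forall>(b, c) \<in> set bs. prime_pf b \<and> sorted b"
    using assms unfolding ndspf_def by blast
  show ?thesis
    unfolding w using bs
  proof (induction bs)
    case (Cons bc bs)
    obtain b c where bc: "bc = (b, c)" by fastforce
    have "nd_signed (map (\<lambda>x. (x, c)) b)"
      using Cons.prems by (auto simp: bc nd_signed_def cpf_def prime_pf_def separated_def o_def)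
    then show ?case using Cons by (simp add: bc nd_signed_bullet)
  qed (simp add: nd_signed_Nil)
qed

lemma sorted_partition:
  "sorted (map f xs) \<Longrightarrow> filter (\<lambda>x. f x \<le> b) xs @ filter (\<lambda>x. \<not> f x \<le> b) xs = xs"
proof (induction xs)
  case (Cons x xs)
  show ?case
  proof (cases "f x \<le> b")
    case False
    then have "\<forall>y\<in>set xs. \<not> f y \<le> b" using Cons.prems by auto
    then show ?thesis using False by simp
  qed (use Cons in simp)
qed simp

text \<open>The letters up to the least positive \<open>b\<close> with exactly \<open>b\<close>
  letters at most \<open>b\<close> form the first prime factor \<open>v\<close>. A separator between
  two of its letters would be a smaller such value, so \<open>v\<close> has one color; induction
  handles the rest.\<close>

lemma nd_signed_ndspf:
  assumes "nd_signed w" shows "w \<in> ndspf"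
  using assms
proof (induction w rule: length_induct)
  case (1 w)
  let ?w = "map fst w"
  have srt: "sorted ?w" and sep: "separated w" and cw: "cpf w"
    using 1(2) by (auto simp: nd_signed_def)
  have pos: "0 \<notin> set ?w" and ge: "i \<le> length w \<Longrightarrow> i \<le> letters_le i ?w" for i
    using cw by (auto simp: cpf_def parking_function_iff)
  show ?case
  proof (cases "w = []")
    case True
    then show ?thesis unfolding ndspf_def by (auto intro!: exI[of _ "[]"])
  next
    case False
    define Q where "Q b \<longleftrightarrow> 1 \<le> b \<and> letters_le b ?w = b" for b
    define b where "b = (LEAST b. Q b)"
    have n: "Q (length w)"
      using False ge[of "length w"] letters_le_bound[of "length w" ?w]
      by (simp add: Q_def Suc_le_eq)
    have b: "1 \<le> b" "letters_le b ?w = b" "b \<le> length w"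
      using LeastI[of Q, OF n] Least_le[of Q, OF n] by (auto simp: b_def Q_def)
    have b_min: "b \<le> b'" if "1 \<le> b'" "letters_le b' ?w = b'" for b'
      using that unfolding b_def by (intro Least_le) (simp add: Q_def)
    define v where "v = filter (\<lambda>p. fst p \<le> b) w"
    define u0 where "u0 = filter (\<lambda>p. \<not> fst p \<le> b) w"
    define u where "u = map (\<lambda>(x, c). (x - b, c)) u0"
    have w: "w = v @ u0" using sorted_partition[OF srt] by (simp add: v_def u0_def)
    have fv: "map fst v = filter (\<lambda>x. x \<le> b) ?w" by (simp add: v_def filter_map o_def)
    have lv: "length v = b"
      using b(2) by (simp add: letters_le_filter v_def filter_map o_def)
    have u0: "u0 = cshift b u"
      unfolding u_def cshift_def map_map by (rule map_idI[symmetric]) (auto simp: u0_def)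
    have wvu: "w = v \<bullet>\<^sub>c u" unfolding cbullet_def lv u0[symmetric] by (rule w)
    have fu0: "map fst u0 = map (\<lambda>x. x + b) (map fst u)" by (simp only: u0 map_fst_cshift)
    have fu: "map fst u = map (\<lambda>x. x - b) (map fst u0)" by (simp add: u_def o_def case_prod_unfold)
    have "nd_signed u"
      unfolding nd_signed_def
    proof (intro conjI)
      have "sorted (map fst u0)" using srt unfolding w by (simp add: sorted_append)
      then show "sorted (map fst u)"
        unfolding fu by (auto simp: sorted_wrt_map intro: sorted_wrt_mono_rel[rotated])
      have "0 \<notin> set (map fst u)" by (auto simp: u_def u0_def)
      moreover have "i \<le> letters_le i (map fst u)" if "i \<le> length u" for i
      proof -
        \<comment> \<open>At most \<open>b\<close> of the letters counted here belong to
          \<open>v\<close>, which leaves at least \<open>i\<close> for \<open>u\<close>.\<close>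
        have "i + b \<le> letters_le (i + b) ?w"
          using that lv by (intro ge) (simp add: wvu cbullet_def)
        also have "\<dots> = letters_le (i + b) (map fst v) + letters_le i (map fst u)"
          by (subst w) (simp add: letters_le_append fu0 letters_le_shift del: map_map)
        finally show ?thesis using letters_le_bound[of "i + b" "map fst v"] lv by simp
      qed
      ultimately show "cpf u" by (simp add: cpf_def parking_function_iff)
      show "separated u"
        unfolding separated_def
      proof (intro ballI impI)
        fix p q assume pq: "p \<in> set u" "q \<in> set u" "snd p \<noteq> snd q" "fst p \<le> fst q"
        have "(fst r + b, snd r) \<in> set w" if "r \<in> set u" for r
          using that unfolding w u0 by (force simp: cshift_def)
        \<comment> \<open>The letters are moved back into \<open>w\<close>, where a separator
          exists; it is at least \<open>b\<close>, so it can be shifted down by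
          \<open>b\<close>.\<close>
        from this[OF pq(1)] this[OF pq(2)] obtain b' where
          b': "fst p + b \<le> b'" "b' < fst q + b" "tight b' ?w"
          using sep pq(3,4) unfolding separated_def by fastforce
        have "cnt c (b' - b) (map fst u) \<le> b' - b - c" if "c \<le> b' - b" for c
        proof -
          have "cnt c (b' - b) (map fst u) = cnt (c + b) b' (map fst u0)"
            unfolding fu0 by (simp add: cnt_shift_ge del: map_map)
          also have "\<dots> \<le> cnt (c + b) b' ?w" by (subst w) (simp add: cnt_append)
          also have "\<dots> \<le> b' - (c + b)" using b'(1,3) that by (auto simp: tight_def)
          finally show ?thesis by simp
        qed
        then show "\<exists>b. fst p \<le> b \<and> b < fst q \<and> tight b (map fst u)"
          using b' by (intro exI[of _ "b' - b"]) (auto simp: tight_def)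
      qed
    qed
    moreover have "length u < length w" using b(1) lv by (simp add: wvu cbullet_def)
    ultimately have "u \<in> ndspf" using 1(1) by blast
    then obtain bs where bs: "u = foldr (\<bullet>\<^sub>c) (map (\<lambda>(b, c). map (\<lambda>x. (x, c)) b) bs) []"
      "\<forall>(b, c) \<in> set bs. prime_pf b \<and> sorted b"
      unfolding ndspf_def by blast
    have le: "snd p = snd q" if pq: "p \<in> set v" "q \<in> set v" "fst p \<le> fst q" for p q
    proof (rule ccontr)
      assume "snd p \<noteq> snd q"
      then obtain b' where b': "fst p \<le> b'" "b' < fst q" "tight b' ?w"
        using sep pq unfolding separated_def w by fastforce
      have "b' < b" using b'(2) pq(2) by (simp add: v_def)
      have "1 \<le> fst p" using pos pq(1) by (auto simp: v_def Suc_le_eq image_iff intro!: gr0I)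
      \<comment> \<open>Taking \<open>c = 0\<close> in \<open>tight b'\<close> bounds the count
        above by \<open>b'\<close>; the parking condition bounds it below, so equality contradicts
        the minimality of \<open>b\<close>.\<close>
      moreover have "letters_le b' ?w \<le> b'"
        using b'(3) cnt_0[OF pos, of b'] by (auto simp: tight_def)
      ultimately have "b \<le> b'"
        using ge[of b'] \<open>b' < b\<close> b(3) b'(1) by (intro b_min) auto
      then show False using \<open>b' < b\<close> by simp
    qed
    define c where "c = snd (hd v)"
    have "v \<noteq> []" using lv b(1) by auto
    then have "snd p = c" if "p \<in> set v" for p
      using le[of p "hd v"] le[of "hd v" p] that unfolding c_def
      by (metis hd_in_set nat_le_linear)
    then have vc: "v = map (\<lambda>x. (x, c)) (map fst v)"
      by (auto simp: map_idI prod_eq_iff intro!: map_idI[symmetric])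
    have lev: "letters_le i (map fst v) = letters_le i ?w" if "i \<le> b" for i
      using that unfolding fv letters_le_filter filter_filter
      by (intro arg_cong[of _ _ length] filter_cong) auto
    have "0 \<notin> set (map fst v)" using pos by (auto simp: v_def)
    then have "parking_function (map fst v)"
      using ge b(3) by (simp add: parking_function_iff lv lev)
    moreover have "{b' \<in> {1..b}. letters_le b' (map fst v) = b'} = {b}"
      using b b_min by (auto simp: lev) (metis One_nat_def antisym)
    ultimately have "prime_pf (map fst v)" using \<open>v \<noteq> []\<close> by (simp add: prime_pf_def lv)
    moreover have "sorted (map fst v)" unfolding v_def using srt by (rule sorted_filter)
    ultimately have "\<forall>(b, c) \<in> set ((map fst v, c) # bs). prime_pf b \<and> sorted b" using bs(2) by simp
    moreover have "w = foldr (\<bullet>\<^sub>c) (map (\<lambda>(b, c). map (\<lambda>x. (x, c)) b) ((map fst v, c) # bs)) []"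
      using wvu vc bs(1) by simp
    ultimately show ?thesis unfolding ndspf_def by blast
  qed
qed

section \<open>The subspace spanned by the sums over rearrangement classes\<close>

lemma ndspf_eq: "ndspf = Collect nd_signed"
  using ndspf_nd_signed nd_signed_ndspf by blast

text \<open>The value of a letter determines its color, so sorting by value has only one possible
  outcome.\<close>

lemma nd_signed_unique:
  assumes "nd_signed v" "nd_signed w" "mset v = mset w" shows "v = w"
proof -
  have "inj_on fst (set w)" using assms(2) by (simp add: nd_signed_def separated_inj)
  moreover have "set v = set w" using assms(3) by (rule mset_eq_setD)
  ultimately have "sort_key fst w = v" "sort_key fst w = w"
    using assms by (auto simp: nd_signed_def intro!: sort_key_inj_key_eq)
  then show ?thesis by simp
qed

lemma separated_rearrange:
  assumes "cpf w" "separated w" obtains \<pi> where "nd_signed \<pi>" "mset \<pi> = mset w"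
proof (rule that[of "sort_key fst w"])
  show "nd_signed (sort_key fst w)"
    unfolding nd_signed_def
    using assms cpf_cong[of "sort_key fst w" w] by (auto intro: separated_mono[of _ w])
qed simp

abbreviation perms :: "'a multiset \<Rightarrow> 'a list set" where
  "perms \<equiv> permutations_of_multiset"

lemma P_perms: "cpf \<pi> \<Longrightarrow> \<P> \<pi> = (\<Sum>a\<in>perms (mset \<pi>). \<F> a)"
  unfolding \<P>_def permutations_of_multiset_def
  by (intro sum.cong) (auto dest: cpf_cong)

lemma lookup_sum_basis:
  "finite A \<Longrightarrow> Poly_Mapping.lookup (\<Sum>a\<in>A. \<F> a) b = (if b \<in> A then 1 else 0)"
  by (simp add: lookup_sum basis_elt_def lookup_single when_def sum.delta)

text \<open>Each class contains a single signed representative, so the coefficients at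
  representatives form an identity matrix; injectivity and independence both follow.\<close>

lemma lookup_P:
  assumes "nd_signed v" "nd_signed w"
  shows "Poly_Mapping.lookup (\<P> v) w = (if v = w then 1 else 0)"
proof -
  have "w \<in> perms (mset v) \<longleftrightarrow> v = w"
    using nd_signed_unique[OF assms] by (auto simp: permutations_of_multiset_def)
  then show ?thesis
    using assms(1) by (simp add: P_perms nd_signed_def lookup_sum_basis)
qed

lemma inj_on_P: "inj_on \<P> ndspf"
proof (rule inj_onI)
  fix v w assume "v \<in> ndspf" "w \<in> ndspf" "\<P> v = \<P> w"
  then show "v = w"
    using lookup_P[of v w] lookup_P[of w w] by (simp add: ndspf_eq split: if_splits)
qed

lemma independent_P: "pvec.independent (\<P> ` ndspf)"
proof
  assume "pvec.dependent (\<P> ` ndspf)"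
  then obtain t u v where t: "finite t" "t \<subseteq> \<P> ` ndspf" "(\<Sum>v\<in>t. pscale (u v) v) = 0"
    and v: "v \<in> t" "u v \<noteq> 0"
    unfolding pvec.dependent_explicit by blast
  obtain \<pi> where \<pi>: "v = \<P> \<pi>" "nd_signed \<pi>" using v t(2) by (auto simp: ndspf_eq)
  have "Poly_Mapping.lookup x \<pi> = (if x = v then 1 else 0)" if "x \<in> t" for x
    using that t(2) \<pi> lookup_P by (auto simp: ndspf_eq)
  then have "u v = (\<Sum>x\<in>t. u x * Poly_Mapping.lookup x \<pi>)"
    using t(1) v(1) by (simp add: if_distrib[of "(*) _"] sum.delta cong: if_cong)
  also have "\<dots> = Poly_Mapping.lookup (\<Sum>v\<in>t. pscale (u v) v) \<pi>"
    by (simp add: lookup_sum lookup_pscale)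
  finally show False using v(2) t(3) by simp
qed

section \<open>Products of class sums\<close>

lemma mshuffles_disjoint:
  "set xs \<inter> set ys = {} \<Longrightarrow> mshuffles xs ys = mset_set (shuffles xs ys)"
proof (induction xs ys rule: mshuffles.induct)
  case (3 x xs y ys)
  then have IH: "mshuffles xs (y # ys) = mset_set (shuffles xs (y # ys))"
    "mshuffles (x # xs) ys = mset_set (shuffles (x # xs) ys)" by auto
  \<comment> \<open>The first letter reveals which word supplied it, so no shuffle occurs
    twice.\<close>
  have "(#) x ` shuffles xs (y # ys) \<inter> (#) y ` shuffles (x # xs) ys = {}" using 3(3) by auto
  then show ?case by (simp add: IH image_mset_mset_set mset_set_Union)
qed auto

text \<open>A rearrangement of \<open>A + B\<close> arises exactly once: from its subword of letters
  satisfying \<open>p\<close> and its subword of the other letters.\<close>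

lemma sum_shuffles_perms:
  assumes A: "\<And>x. x \<in># A \<Longrightarrow> p x" and B: "\<And>x. x \<in># B \<Longrightarrow> \<not> p x"
  shows "(\<Sum>a\<in>perms A. \<Sum>b\<in>perms B. \<Sum>w\<in>#mshuffles a b. h w) = (\<Sum>w\<in>perms (A + B). h w)"
proof -
  have ab: "\<forall>x\<in>set a. p x" "\<forall>x\<in>set b. \<not> p x" if "a \<in> perms A" "b \<in> perms B" for a b
    using that A B by (auto simp: permutations_of_multiset_def)
  have f: "filter p w = a" "filter (\<lambda>x. \<not> p x) w = b"
    if "a \<in> perms A" "b \<in> perms B" "w \<in> shuffles a b" for a b w
  proof -
    have "filter p w \<in> shuffles (filter p a) (filter p b)"
      "filter (\<lambda>x. \<not> p x) w \<in> shuffles (filter (\<lambda>x. \<not> p x) a) (filter (\<lambda>x. \<not> p x) b)"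
      using that(3) by (auto simp flip: filter_shuffles)
    moreover have "filter p a = a" "filter p b = []"
      "filter (\<lambda>x. \<not> p x) b = b" "filter (\<lambda>x. \<not> p x) a = []"
      using ab[OF that(1,2)] by (auto simp: filter_id_conv filter_empty_conv)
    ultimately show "filter p w = a" "filter (\<lambda>x. \<not> p x) w = b" by auto
  qed
  have f': "filter p w \<in> perms A" "filter (\<lambda>x. \<not> p x) w \<in> perms B" if "w \<in> perms (A + B)" for w
  proof -
    have "filter_mset p A = A" "filter_mset p B = {#}"
      "filter_mset (\<lambda>x. \<not> p x) B = B" "filter_mset (\<lambda>x. \<not> p x) A = {#}"
      using A B by (auto simp: multiset_eq_iff count_eq_zero_iff)
    then show "filter p w \<in> perms A" "filter (\<lambda>x. \<not> p x) w \<in> perms B"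
      using that by (auto simp: permutations_of_multiset_def)
  qed
  have "(\<Sum>a\<in>perms A. \<Sum>b\<in>perms B. \<Sum>w\<in>#mshuffles a b. h w) =
    (\<Sum>a\<in>perms A. \<Sum>b\<in>perms B. \<Sum>w\<in>shuffles a b. h w)"
  proof (intro sum.cong refl)
    fix a b assume "a \<in> perms A" "b \<in> perms B"
    then have "set a \<inter> set b = {}" using ab by blast
    then show "(\<Sum>w\<in>#mshuffles a b. h w) = (\<Sum>w\<in>shuffles a b. h w)"
      by (simp add: mshuffles_disjoint sum_unfold_sum_mset)
  qed
  also have "\<dots> = (\<Sum>(a, b, w)\<in>(SIGMA a:perms A. SIGMA b:perms B. shuffles a b). h w)"
    by (simp add: sum.Sigma)
  also have "\<dots> = (\<Sum>w\<in>perms (A + B). h w)"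
  proof (rule sum.reindex_bij_witness[of _ "\<lambda>w. (filter p w, filter (\<lambda>x. \<not> p x) w, w)"
        "\<lambda>(a, b, w). w"])
    fix x assume "x \<in> (SIGMA a:perms A. SIGMA b:perms B. shuffles a b)"
    then obtain a b w where x: "x = (a, b, w)" "a \<in> perms A" "b \<in> perms B" "w \<in> shuffles a b"
      by auto
    then show "(\<lambda>w. (filter p w, filter (\<lambda>x. \<not> p x) w, w)) ((\<lambda>(a, b, w). w) x) = x"
      using f by simp
    show "(\<lambda>(a, b, w). w) x \<in> perms (A + B)"
      using x by (auto simp: permutations_of_multiset_def mset_shuffles)
    show "h ((\<lambda>(a, b, w). w) x) = (case x of (a, b, w) \<Rightarrow> h w)" by (simp add: x)
  qed (use f' partition_in_shuffles in auto)
  finally show ?thesis .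
qed

lemma P_mult:
  assumes "nd_signed v" "nd_signed w"
  shows "pq_mult (\<P> v) (\<P> w) = \<P> (v \<bullet>\<^sub>c w)"
proof -
  let ?k = "length v"
  note vw = assms[unfolded nd_signed_def]
  have sh: "perms (mset (cshift ?k w)) = cshift ?k ` perms (mset w)"
    unfolding cshift_def mset_map permutations_of_multiset_image ..
  have inj: "inj_on (cshift ?k) X" for X
    unfolding cshift_def by (auto simp: inj_on_def intro!: map_inj_on[of "\<lambda>(x, c). (x + ?k, c)"])
  have "pq_mult (\<P> v) (\<P> w) = (\<Sum>a\<in>perms (mset v). \<Sum>b\<in>perms (mset w). pq_mult (\<F> a) (\<F> b))"
    using vw by (simp add: P_perms, subst pq_mult_sum_left) (simp add: pq_mult_sum_right)
  \<comment> \<open>All rearrangements of \<open>v\<close> have length \<open>?k\<close>, so one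
    shift serves every term. It makes all letters of \<open>w\<close> exceed those of
    \<open>v\<close>, and the test \<open>fst x \<le> ?k\<close> tells them apart.\<close>
  also have "\<dots> = (\<Sum>a\<in>perms (mset v). \<Sum>b\<in>perms (mset (cshift ?k w)). \<Sum>z\<in>#mshuffles a b. \<F> z)"
    unfolding sh sum.reindex[OF inj] o_def pq_mult_basis
    by (intro sum.cong refl) (auto simp: permutations_of_multiset_def dest: mset_eq_length)
  also have "\<dots> = (\<Sum>z\<in>perms (mset v + mset (cshift ?k w)). \<F> z)"
  proof (rule sum_shuffles_perms)
    show "fst x \<le> ?k" if "x \<in># mset v" for x using cpf_le[of v] vw that by auto
    show "\<not> fst x \<le> ?k" if "x \<in># mset (cshift ?k w)" for x
      using cpf_pos[of w] vw that by (force simp: cshift_def intro: gr0I)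
  qed
  also have "\<dots> = \<P> (v \<bullet>\<^sub>c w)"
    using cpf_bullet[of v w] vw by (simp add: P_perms cbullet_def)
  finally show ?thesis .
qed

section \<open>Coproducts of class sums\<close>

lemma splits_eq:
  "{A. A \<subseteq># M} = (\<lambda>(w, i). mset (take i w)) ` (SIGMA w:perms M. {..length w})" (is "?L = ?R")
proof
  show "?R \<subseteq> ?L" using mset_take_subseteq by (fastforce simp: permutations_of_multiset_def)
  show "?L \<subseteq> ?R"
  proof
    fix A assume "A \<in> ?L"
    moreover obtain v u where "mset v = A" "mset u = M - A" by (meson ex_mset)
    ultimately show "A \<in> ?R"
      by (intro image_eqI[of _ _ "(v @ u, length v)"]) (auto simp: permutations_of_multiset_def)
  qed
qed

lemma finite_splits: "finite {A. A \<subseteq># M}"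
  unfolding splits_eq by (intro finite_imageI finite_SigmaI) auto

text \<open>Cutting a rearrangement of \<open>M\<close> amounts to choosing the multiset
  \<open>A\<close> of the prefix and then ordering \<open>A\<close> and \<open>M - A\<close>
  independently.\<close>

lemma sum_deconcatenations:
  "(\<Sum>w\<in>perms M. \<Sum>i\<le>length w. h (take i w) (drop i w)) =
   (\<Sum>A | A \<subseteq># M. \<Sum>v\<in>perms A. \<Sum>u\<in>perms (M - A). h v u)"
proof -
  have "(\<Sum>w\<in>perms M. \<Sum>i\<le>length w. h (take i w) (drop i w)) =
    (\<Sum>(w, i)\<in>(SIGMA w:perms M. {..length w}). h (take i w) (drop i w))"
    by (simp add: sum.Sigma)
  also have "\<dots> = (\<Sum>(A, v, u)\<in>(SIGMA A:{A. A \<subseteq># M}. perms A \<times> perms (M - A)). h v u)"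
  proof (rule sum.reindex_bij_witness[of _ "\<lambda>(A, v, u). (v @ u, length v)"
        "\<lambda>(w, i). (mset (take i w), take i w, drop i w)"])
    fix x assume "x \<in> (SIGMA w:perms M. {..length w})"
    then obtain w i where x: "x = (w, i)" "mset w = M" "i \<le> length w"
      by (auto simp: permutations_of_multiset_def)
    have "mset w = mset (take i w) + mset (drop i w)" by (metis append_take_drop_id mset_append)
    then have "M - mset (take i w) = mset (drop i w)" by (simp add: x(2)[symmetric])
    then show "(\<lambda>(w, i). (mset (take i w), take i w, drop i w)) x \<in>
      (SIGMA A:{A. A \<subseteq># M}. perms A \<times> perms (M - A))"
      using mset_take_subseteq[of i w] by (simp add: x(1) permutations_of_multiset_def x(2))
  qed (auto simp: permutations_of_multiset_def)
  also have "\<dots> = (\<Sum>A | A \<subseteq># M. \<Sum>(v, u)\<in>perms A \<times> perms (M - A). h v u)"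
    by (rule sum.Sigma[symmetric]) (auto simp: finite_splits)
  also have "\<dots> = (\<Sum>A | A \<subseteq># M. \<Sum>v\<in>perms A. \<Sum>u\<in>perms (M - A). h v u)"
    by (simp add: sum.cartesian_product)
  finally show ?thesis .
qed

text \<open>The factor \<open>P(Park A)\<close> of the coproduct, available before a signed parking
  function representing it has been found.\<close>

definition park_sum :: "(nat \<times> bool) multiset \<Rightarrow> pq" where
  "park_sum A = (\<Sum>v\<in>perms A. \<F> (cpark v))"

text \<open>One injective relabelling carries the rearrangements of \<open>w\<close> onto those of
  \<open>cpark w\<close>, and sorting \<open>cpark w\<close> gives the representative.\<close>

lemma park_sum_P:
  assumes "0 \<notin> fst ` set w" "separated w"
  obtains \<pi> where "nd_signed \<pi>" "park_sum (mset w) = \<P> \<pi>"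
proof -
  obtain f where f: "strict_mono_on (fst ` set w) f"
    "\<And>w'. mset w' = mset w \<Longrightarrow> cpark w' = map (map_prod f id) w'"
    using cpark_letter_map[OF assms(1)] by metis
  obtain \<pi> where \<pi>: "nd_signed \<pi>" "mset \<pi> = mset (cpark w)"
    using separated_rearrange[OF cpf_cpark separated_cpark] assms by blast
  have "inj_on f (fst ` set w)" using f(1) by (rule strict_mono_on_imp_inj_on)
  then have "inj_on (map_prod f id) (set w)"
    by (auto simp: inj_on_def)
  moreover have "set v = set w" if "v \<in> perms (mset w)" for v
    using that by (metis permutations_of_multisetD mset_eq_setD)
  ultimately have inj: "inj_on (map (map_prod f id)) (perms (mset w))"
    by (intro inj_onI) (metis map_inj_on sup.idem)
  have "park_sum (mset w) = (\<Sum>v\<in>perms (mset w). \<F> (map (map_prod f id) v))"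
    unfolding park_sum_def by (intro sum.cong) (simp_all add: f(2) permutations_of_multisetD)
  also have "\<dots> = (\<Sum>v\<in>perms (mset \<pi>). \<F> v)"
    unfolding \<pi>(2) f(2)[OF refl] mset_map permutations_of_multiset_image
    by (simp add: sum.reindex[OF inj])
  also have "\<dots> = \<P> \<pi>" using \<pi>(1) by (simp add: P_perms nd_signed_def)
  finally show thesis using \<pi>(1) that by blast
qed

lemma tensor_park_sum:
  "tensor (park_sum A) (park_sum B) = (\<Sum>v\<in>perms A. \<Sum>u\<in>perms B. basis_elt (cpark v, cpark u))"
  by (simp add: tensor_def park_sum_def lin_ext_sum)

lemma comult_P:
  assumes "cpf \<pi>"
  shows "pq_comult (\<P> \<pi>) = (\<Sum>A | A \<subseteq># mset \<pi>. tensor (park_sum A) (park_sum (mset \<pi> - A)))"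
  unfolding tensor_park_sum sum_deconcatenations[symmetric]
  by (simp add: P_perms[OF assms] pq_comult_def lin_ext_sum)

lemma tensor_swap_park_sum:
  "tensor_swap (tensor (park_sum A) (park_sum B)) = tensor (park_sum B) (park_sum A)"
  unfolding tensor_park_sum
  by (simp add: tensor_swap_def lin_ext_sum) (rule sum.swap)

lemma tensor_swap_comult_P:
  assumes "cpf \<pi>" shows "tensor_swap (pq_comult (\<P> \<pi>)) = pq_comult (\<P> \<pi>)"
proof -
  let ?M = "mset \<pi>"
  have dd: "?M - (?M - A) = A" if "A \<subseteq># ?M" for A
    using that by (simp add: multiset_eq_iff subseteq_mset_def)
  have "tensor_swap (pq_comult (\<P> \<pi>)) =
    (\<Sum>A | A \<subseteq># ?M. tensor (park_sum (?M - A)) (park_sum A))"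
    by (simp add: comult_P[OF assms] tensor_swap_def lin_ext_sum
        tensor_swap_park_sum[unfolded tensor_swap_def])
  also have "\<dots> = (\<Sum>A | A \<subseteq># ?M. tensor (park_sum A) (park_sum (?M - A)))"
    \<comment> \<open>Complementation is an involution on the submultisets of
      \<open>?M\<close>.\<close>
    by (rule sum.reindex_bij_witness[of _ "\<lambda>A. ?M - A" "\<lambda>A. ?M - A"])
      (auto simp: dd diff_subset_eq_self)
  finally show ?thesis by (simp add: comult_P[OF assms])
qed

section \<open>Closure of the span under the Hopf operations\<close>

lemma P_span_mult:
  "f \<in> pvec.span (\<P> ` ndspf) \<Longrightarrow> g \<in> pvec.span (\<P> ` ndspf) \<Longrightarrow>
    pq_mult f g \<in> pvec.span (\<P> ` ndspf)"
  by (rule pq_mult_span_closed)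
    (auto simp: ndspf_eq P_mult intro!: pvec.span_base imageI nd_signed_bullet)

lemma P_Nil: "\<P> [] = pq_one"
  using nd_signed_Nil by (simp add: P_perms nd_signed_def pq_one_def)

lemma P_span_one: "pq_one \<in> pvec.span (\<P> ` ndspf)"
  unfolding P_Nil[symmetric] by (intro pvec.span_base imageI) (simp add: ndspf_eq nd_signed_Nil)

lemma park_sum_span:
  assumes "0 \<notin> fst ` set w" "separated w" "A \<subseteq># mset w"
  shows "park_sum A \<in> pvec.span (\<P> ` ndspf)"
proof -
  obtain v where v: "mset v = A" by (meson ex_mset)
  then have "set v \<subseteq> set w" using set_mset_mono[OF assms(3)] by auto
  then have "0 \<notin> fst ` set v" "separated v"
    using assms separated_mono[of v w] v by auto
  then obtain \<pi> where "nd_signed \<pi>" "park_sum A = \<P> \<pi>" using park_sum_P v by metis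
  then show ?thesis by (auto simp: ndspf_eq intro!: pvec.span_base)
qed

text \<open>Summed over a class, the recursion becomes a sum over submultisets \<open>A\<close> of
  products of a smaller class sum with \<open>park_sum\<close> of the complement.\<close>

lemma antipode_sum_span:
  assumes "0 \<notin> fst ` set w" "separated w"
  shows "(\<Sum>v\<in>perms (mset w). antipode_word v) \<in> pvec.span (\<P> ` ndspf)"
  using assms
proof (induction w rule: length_induct)
  case (1 w)
  let ?M = "mset w" and ?H = "pvec.span (\<P> ` ndspf)"
  show ?case
  proof (cases "w = []")
    case False
    \<comment> \<open>The value 0 at an empty right factor removes the term
      \<open>i = length v\<close>, so the recursion can be written over all cuts and
      \<open>sum_deconcatenations\<close> applies.\<close>
    define h where "h v u = (if u = [] then 0 else pq_mult (antipode_word v) (\<F> (cpark u)))"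
      for v u :: cword
    have T: "antipode_word v = - (\<Sum>i\<le>length v. h (take i v) (drop i v))" if "v \<in> perms ?M" for v
    proof -
      have "v \<noteq> []" using that False by (auto simp: permutations_of_multiset_def)
      moreover have "{..length v} = insert (length v) {..<length v}" by auto
      moreover have "(\<Sum>i<length v. h (take i v) (drop i v)) =
        (\<Sum>i<length v. pq_mult (antipode_word (take i v)) (\<F> (cpark (drop i v))))"
        by (intro sum.cong) (auto simp: h_def)
      ultimately show ?thesis by (subst antipode_word.simps) (simp add: h_def)
    qed
    have "(\<Sum>v\<in>perms A. \<Sum>u\<in>perms (?M - A). h v u) \<in> ?H" if A: "A \<subseteq># ?M" for A
    proof (cases "A = ?M")
      case True
      then show ?thesis by (simp add: h_def pvec.span_zero)
    next
      case ne: False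
      obtain v where v: "mset v = A" by (meson ex_mset)
      have "length v < length w"
        using A ne v mset_subset_size[of A ?M] by (auto simp: subset_mset.less_le)
      moreover have "0 \<notin> fst ` set v" using set_mset_mono[OF A] v 1(2) by auto
      moreover have "separated v" using separated_mono[of v w] v A 1(3) by simp
      ultimately have IH: "(\<Sum>v\<in>perms A. antipode_word v) \<in> ?H" using 1(1) v by blast
      have "?M - A \<noteq> {#}" using A ne by (metis Diff_eq_empty_iff_mset subset_mset.antisym)
      then have "u \<noteq> []" if "u \<in> perms (?M - A)" for u
        using that by (auto simp: permutations_of_multiset_def)
      \<comment> \<open>For a proper submultiset the right factor is never empty, so
        \<open>h\<close> is a genuine product and the double sum factors.\<close>
      then have "(\<Sum>v\<in>perms A. \<Sum>u\<in>perms (?M - A). h v u) =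
        pq_mult (\<Sum>v\<in>perms A. antipode_word v) (park_sum (?M - A))"
        unfolding park_sum_def
        by (subst pq_mult_sum_left) (simp add: h_def pq_mult_sum_right)
      then show ?thesis
        using P_span_mult[OF IH park_sum_span[OF 1(2,3)]] by simp
    qed
    then have "(\<Sum>v\<in>perms ?M. \<Sum>i\<le>length v. h (take i v) (drop i v)) \<in> ?H"
      unfolding sum_deconcatenations by (auto intro: pvec.span_sum)
    then show ?thesis by (simp add: T sum_negf pvec.span_neg)
  qed (simp add: P_span_one)
qed

text \<open>For the coproduct and the antipode, the elements sent into the required space form a
  subspace, so checking each \<open>\<P> \<pi>\<close> is enough.\<close>

lemma hopf_subalgebra_P: "hopf_subalgebra (pvec.span (\<P> ` ndspf))"
proof -
  let ?H = "pvec.span (\<P> ` ndspf)" and ?S = "lin_ext antipode_word"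
  have nd: "cpf \<pi>" "separated \<pi>" "0 \<notin> fst ` set \<pi>" if "\<pi> \<in> ndspf" for \<pi>
    using that by (auto simp: ndspf_eq nd_signed_def dest: cpf_pos)
  have "\<P> \<pi> \<in> PQSym2" if "\<pi> \<in> ndspf" for \<pi>
    unfolding \<P>_def by (intro pvec.subspace_sum subspace_PQSym2 PQSym2_basis) simp
  then have 1: "?H \<subseteq> PQSym2" by (intro pvec.span_minimal subspace_PQSym2) auto
  have "pq_comult (\<P> \<pi>) \<in> tensor_space ?H ?H" if "\<pi> \<in> ndspf" for \<pi>
    unfolding comult_P[OF nd(1)[OF that]] tensor_space_def
    by (intro pvec.span_sum pvec.span_base)
      (auto intro!: exI park_sum_span[OF nd(3,2)[OF that]])
  then have 2: "?H \<subseteq> {f. pq_comult f \<in> tensor_space ?H ?H}"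
    by (intro pvec.span_minimal pvec.subspaceI)
      (auto simp: pq_comult_def lin_ext_0 lin_ext_add lin_ext_scale tensor_space_def
        intro: pvec.span_add pvec.span_scale pvec.span_zero)
  have "?S (\<P> \<pi>) \<in> ?H" if "\<pi> \<in> ndspf" for \<pi>
    using antipode_sum_span[of \<pi>] nd[OF that] by (simp add: P_perms lin_ext_sum)
  then have 3: "?H \<subseteq> {f. ?S f \<in> ?H}"
    by (intro pvec.span_minimal pvec.subspaceI)
      (auto simp: lin_ext_0 lin_ext_add lin_ext_scale
        intro: pvec.span_add pvec.span_scale pvec.span_zero)
  show ?thesis
    unfolding hopf_subalgebra_def
    using 1 2 3 P_span_one P_span_mult pq_antipode_lin_ext by blast
qed

lemma cocommutative_P: "cocommutative_on (pvec.span (\<P> ` ndspf))"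
proof -
  have "pvec.span (\<P> ` ndspf) \<subseteq> {f. tensor_swap (pq_comult f) = pq_comult f}"
    by (intro pvec.span_minimal pvec.subspaceI)
      (auto simp: ndspf_eq nd_signed_def tensor_swap_comult_P,
       auto simp: tensor_swap_def pq_comult_def lin_ext_0 lin_ext_add lin_ext_scale)
  then show ?thesis unfolding cocommutative_on_def by blast
qed

theorem theorem6p3:
  "\<exists>H. hopf_subalgebra H \<and> cocommutative_on H \<and>
       inj_on \<P> ndspf \<and> pvec.independent (\<P> ` ndspf) \<and> pvec.span (\<P> ` ndspf) = H"
  using hopf_subalgebra_P cocommutative_P inj_on_P independent_P by blast

end
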